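(* Let $A$ be a ring with unity, $\mathfrak C$ an $A$-coring, and $\Sigma$ a right $\mathfrak C$-comodule with coaction $u\mapsto u_{[0]}\otimes_A u_{[1]}$. Let $R$ be a firm ring and $\iota:R\to\Sigma\otimes_A\Sigma^*$ a ring homomorphism such that, for the left $R$-action on $\Sigma$ induced by $\iota$, $\Sigma$ is an $R$-$\mathfrak C$-bicomodule and ${}_R\Sigma$ is firm. Then the map $$\mathsf{can}:\Sigma^*\otimes_R\Sigma\to\mathfrak C,\qquad \phi\otimes_R x\mapsto\phi(x_{[0]})x_{[1]},$$ is a homomorphism of $A$-corings, where $\Sigma^*\otimes_R\Sigma$ is the comatrix $A$-coring.
   Context: Rings are associative (over a fixed commutative unital ring $K$) and need not have a unity; modules over unital rings are unital. A left $R$-module $M$ is firm if $\varpi_M:R\otimes_R M\to M$, $r\otimes m\mapsto rm$, is bijective; $d_M$ denotes its inverse, written $d_M(m)=r\otimes_R m^r$ (sum understood). A ring $R$ is firm if $R\otimes_R R\to R$ is bijective. $\mathfrak C$ has coassociative comultiplication and a counit; comodules are counital. $\Sigma^*=\mathrm{Hom}_A(\Sigma,A)$ (right $A$-linear maps). The (possibly non-unital) ring structure on $\Sigma\otimes_A\Sigma^*$ is $(x\otimes\phi)(y\otimes\psi)=x\phi(y)\otimes\psi$. Writing $\iota(r)=e_r\otimes_A\varphi_r$ (sum understood), $R$ acts by $ru=e_r\varphi_r(u)$ on $\Sigma$ and by $\phi r=\phi(e_r)\varphi_r$ on $\Sigma^*$, i.e. $(\phi r)(u)=\phi(ru)$.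 $\Sigma$ being an $R$-$\mathfrak C$-bicomodule means that the coaction $\Sigma\to\Sigma\otimes_A\mathfrak C$ is left $R$-linear. The comatrix coring $\Sigma^*\otimes_R\Sigma$ has comultiplication $\Delta(\phi\otimes_R u)=\phi\otimes_R e_r\otimes_A\varphi_r\otimes_R u^r$ (where $d_\Sigma(u)=r\otimes_R u^r$) and counit $\phi\otimes_R u\mapsto\phi(u)$. *)

theory Defs
  imports "HOL-Algebra.Module" "HOL-Algebra.Free_Abelian_Groups"
begin

text \<open>
  Conventions.  Everything lives over a commutative unital ring \<open>K\<close>: a ring is a \<open>K\<close>-algebra, all
  modules are \<open>K\<close>-modules and all maps are \<open>K\<close>-linear.  A \<open>K\<close>-algebra is a \<open>module\<close> record that also
  uses the field \<open>mult\<close>; its field \<open>one\<close> is meaningful only if the algebra is required to be unital.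
  The fields \<open>mult\<close> and \<open>one\<close> of a record standing for a mere module are unused.
\<close>

locale nonunital_algebra = module K A for K :: "'k ring" and A :: "('k, 'a, 'e) module_scheme" +
  assumes alg_closed: "\<lbrakk>a \<in> carrier A; b \<in> carrier A\<rbrakk> \<Longrightarrow> a \<otimes>\<^bsub>A\<^esub> b \<in> carrier A"
    and alg_assoc: "\<lbrakk>a \<in> carrier A; b \<in> carrier A; c \<in> carrier A\<rbrakk>
      \<Longrightarrow> (a \<otimes>\<^bsub>A\<^esub> b) \<otimes>\<^bsub>A\<^esub> c = a \<otimes>\<^bsub>A\<^esub> (b \<otimes>\<^bsub>A\<^esub> c)"
    and alg_distr_l: "\<lbrakk>a \<in> carrier A; b \<in> carrier A; c \<in> carrier A\<rbrakk>
      \<Longrightarrow> (a \<oplus>\<^bsub>A\<^esub> b) \<otimes>\<^bsub>A\<^esub> c = (a \<otimes>\<^bsub>A\<^esub> c) \<oplus>\<^bsub>A\<^esub> (b \<otimes>\<^bsub>A\<^esub> c)"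
    and alg_distr_r: "\<lbrakk>a \<in> carrier A; b \<in> carrier A; c \<in> carrier A\<rbrakk>
      \<Longrightarrow> a \<otimes>\<^bsub>A\<^esub> (b \<oplus>\<^bsub>A\<^esub> c) = (a \<otimes>\<^bsub>A\<^esub> b) \<oplus>\<^bsub>A\<^esub> (a \<otimes>\<^bsub>A\<^esub> c)"
    and alg_smult_l: "\<lbrakk>k \<in> carrier K; a \<in> carrier A; b \<in> carrier A\<rbrakk>
      \<Longrightarrow> (k \<odot>\<^bsub>A\<^esub> a) \<otimes>\<^bsub>A\<^esub> b = k \<odot>\<^bsub>A\<^esub> (a \<otimes>\<^bsub>A\<^esub> b)"
    and alg_smult_r: "\<lbrakk>k \<in> carrier K; a \<in> carrier A; b \<in> carrier A\<rbrakk>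
      \<Longrightarrow> a \<otimes>\<^bsub>A\<^esub> (k \<odot>\<^bsub>A\<^esub> b) = k \<odot>\<^bsub>A\<^esub> (a \<otimes>\<^bsub>A\<^esub> b)"

locale unital_algebra = nonunital_algebra K A + monoid A
  for K :: "'k ring" and A :: "('k, 'a, 'e) module_scheme"

definition linear_map ::
    "'k ring \<Rightarrow> ('k, 'm, 'd) module_scheme \<Rightarrow> ('k, 'n, 'e) module_scheme \<Rightarrow> ('m \<Rightarrow> 'n) \<Rightarrow> bool" where
  "linear_map K M N f \<longleftrightarrow> f \<in> carrier M \<rightarrow> carrier N \<and>
     (\<forall>x \<in> carrier M. \<forall>y \<in> carrier M. f (x \<oplus>\<^bsub>M\<^esub> y) = f x \<oplus>\<^bsub>N\<^esub> f y) \<and>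
     (\<forall>k \<in> carrier K. \<forall>x \<in> carrier M. f (k \<odot>\<^bsub>M\<^esub> x) = k \<odot>\<^bsub>N\<^esub> f x)"

definition algebra_hom ::
    "'k ring \<Rightarrow> ('k, 'a, 'd) module_scheme \<Rightarrow> ('k, 'b, 'e) module_scheme \<Rightarrow> ('a \<Rightarrow> 'b) \<Rightarrow> bool" where
  "algebra_hom K A B f \<longleftrightarrow> linear_map K A B f \<and>
     (\<forall>x \<in> carrier A. \<forall>y \<in> carrier A. f (x \<otimes>\<^bsub>A\<^esub> y) = f x \<otimes>\<^bsub>B\<^esub> f y)"


section \<open>Modules and bimodules\<close>

text \<open>One record serves for left modules (\<open>ract\<close> unused), right modules (\<open>lact\<close> unused) and bimodules.\<close>

record ('k, 'l, 'r, 'm) bimodule = "('k, 'm) module" +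
  lact :: "'l \<Rightarrow> 'm \<Rightarrow> 'm"
  ract :: "'m \<Rightarrow> 'r \<Rightarrow> 'm"

locale left_module = L: nonunital_algebra K L + M: module K M
  for K :: "'k ring" and L :: "('k, 'l) module" and M :: "('k, 'l, 'r, 'm, 'e) bimodule_scheme" +
  assumes lact_closed: "\<lbrakk>a \<in> carrier L; x \<in> carrier M\<rbrakk> \<Longrightarrow> lact M a x \<in> carrier M"
    and lact_add_l: "\<lbrakk>a \<in> carrier L; b \<in> carrier L; x \<in> carrier M\<rbrakk>
      \<Longrightarrow> lact M (a \<oplus>\<^bsub>L\<^esub> b) x = lact M a x \<oplus>\<^bsub>M\<^esub> lact M b x"
    and lact_add_r: "\<lbrakk>a \<in> carrier L; x \<in> carrier M; y \<in> carrier M\<rbrakk>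
      \<Longrightarrow> lact M a (x \<oplus>\<^bsub>M\<^esub> y) = lact M a x \<oplus>\<^bsub>M\<^esub> lact M a y"
    and lact_assoc: "\<lbrakk>a \<in> carrier L; b \<in> carrier L; x \<in> carrier M\<rbrakk>
      \<Longrightarrow> lact M (a \<otimes>\<^bsub>L\<^esub> b) x = lact M a (lact M b x)"
    and lact_smult_l: "\<lbrakk>k \<in> carrier K; a \<in> carrier L; x \<in> carrier M\<rbrakk>
      \<Longrightarrow> lact M (k \<odot>\<^bsub>L\<^esub> a) x = k \<odot>\<^bsub>M\<^esub> lact M a x"
    and lact_smult_r: "\<lbrakk>k \<in> carrier K; a \<in> carrier L; x \<in> carrier M\<rbrakk>
      \<Longrightarrow> lact M a (k \<odot>\<^bsub>M\<^esub> x) = k \<odot>\<^bsub>M\<^esub> lact M a x"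

locale right_module = S: nonunital_algebra K S + M: module K M
  for K :: "'k ring" and S :: "('k, 'r) module" and M :: "('k, 'l, 'r, 'm, 'e) bimodule_scheme" +
  assumes ract_closed: "\<lbrakk>x \<in> carrier M; a \<in> carrier S\<rbrakk> \<Longrightarrow> ract M x a \<in> carrier M"
    and ract_add_l: "\<lbrakk>x \<in> carrier M; y \<in> carrier M; a \<in> carrier S\<rbrakk>
      \<Longrightarrow> ract M (x \<oplus>\<^bsub>M\<^esub> y) a = ract M x a \<oplus>\<^bsub>M\<^esub> ract M y a"
    and ract_add_r: "\<lbrakk>x \<in> carrier M; a \<in> carrier S; b \<in> carrier S\<rbrakk>
      \<Longrightarrow> ract M x (a \<oplus>\<^bsub>S\<^esub> b) = ract M x a \<oplus>\<^bsub>M\<^esub> ract M x b"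
    and ract_assoc: "\<lbrakk>x \<in> carrier M; a \<in> carrier S; b \<in> carrier S\<rbrakk>
      \<Longrightarrow> ract M x (a \<otimes>\<^bsub>S\<^esub> b) = ract M (ract M x a) b"
    and ract_smult_l: "\<lbrakk>k \<in> carrier K; x \<in> carrier M; a \<in> carrier S\<rbrakk>
      \<Longrightarrow> ract M (k \<odot>\<^bsub>M\<^esub> x) a = k \<odot>\<^bsub>M\<^esub> ract M x a"
    and ract_smult_r: "\<lbrakk>k \<in> carrier K; x \<in> carrier M; a \<in> carrier S\<rbrakk>
      \<Longrightarrow> ract M x (k \<odot>\<^bsub>S\<^esub> a) = k \<odot>\<^bsub>M\<^esub> ract M x a"

locale bimodule = left_module K L M + right_module K S M
  for K :: "'k ring" and L :: "('k, 'l) module" and S :: "('k, 'r) module"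
    and M :: "('k, 'l, 'r, 'm, 'e) bimodule_scheme" +
  assumes lact_ract: "\<lbrakk>a \<in> carrier L; x \<in> carrier M; b \<in> carrier S\<rbrakk>
      \<Longrightarrow> ract M (lact M a x) b = lact M a (ract M x b)"

locale unital_right_module = A: unital_algebra K A + right_module K A M
  for K :: "'k ring" and A :: "('k, 'r) module" and M :: "('k, 'l, 'r, 'm, 'e) bimodule_scheme" +
  assumes ract_one: "x \<in> carrier M \<Longrightarrow> ract M x \<one>\<^bsub>A\<^esub> = x"

locale unital_bimodule = bimodule K A A M + unital_right_module K A M
  for K :: "'k ring" and A :: "('k, 'a) module" and M :: "('k, 'a, 'a, 'm, 'e) bimodule_scheme" +
  assumes lact_one: "x \<in> carrier M \<Longrightarrow> lact M \<one>\<^bsub>A\<^esub> x = x"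

definition left_linear ::
    "('k, 'l) module \<Rightarrow> ('k, 'l, 'r, 'm, 'd) bimodule_scheme \<Rightarrow>
     ('k, 'l, 's, 'n, 'e) bimodule_scheme \<Rightarrow> ('m \<Rightarrow> 'n) \<Rightarrow> bool" where
  "left_linear L M N f \<longleftrightarrow> (\<forall>a \<in> carrier L. \<forall>x \<in> carrier M. f (lact M a x) = lact N a (f x))"

definition right_linear ::
    "('k, 'r) module \<Rightarrow> ('k, 'l, 'r, 'm, 'd) bimodule_scheme \<Rightarrow>
     ('k, 's, 'r, 'n, 'e) bimodule_scheme \<Rightarrow> ('m \<Rightarrow> 'n) \<Rightarrow> bool" where
  "right_linear S M N f \<longleftrightarrow> (\<forall>x \<in> carrier M. \<forall>a \<in> carrier S. f (ract M x a) = ract N (f x) a)"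

definition regular :: "('k, 'a) module \<Rightarrow> ('k, 'a, 'a, 'a) bimodule" where
  "regular A = module.extend A (bimodule.fields (monoid.mult A) (monoid.mult A))"


section \<open>Tensor products over a possibly non-unital algebra\<close>

text \<open>
  \<open>P \<otimes>\<^sub>S Q\<close> is the free abelian group on \<open>P \<times> Q\<close> modulo the bilinearity, \<open>S\<close>-balancing and
  \<open>K\<close>-balancing relations; the last ones make it a quotient of \<open>P \<otimes>\<^sub>K Q\<close>.  Its elements are cosets.
\<close>

type_synonym ('p, 'q) tensor_elem = "('p \<times> 'q \<Rightarrow>\<^sub>0 int) set"

definition tensor_relations ::
    "'k ring \<Rightarrow> ('k, 's) module \<Rightarrow> ('k, 'l, 's, 'p, 'd) bimodule_scheme \<Rightarrow>
     ('k, 's, 'r, 'q, 'e) bimodule_scheme \<Rightarrow> ('p \<times> 'q \<Rightarrow>\<^sub>0 int) set" where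
  "tensor_relations K S P Q =
     {frag_of (p \<oplus>\<^bsub>P\<^esub> p', q) - frag_of (p, q) - frag_of (p', q) | p p' q.
        p \<in> carrier P \<and> p' \<in> carrier P \<and> q \<in> carrier Q} \<union>
     {frag_of (p, q \<oplus>\<^bsub>Q\<^esub> q') - frag_of (p, q) - frag_of (p, q') | p q q'.
        p \<in> carrier P \<and> q \<in> carrier Q \<and> q' \<in> carrier Q} \<union>
     {frag_of (ract P p s, q) - frag_of (p, lact Q s q) | p s q.
        p \<in> carrier P \<and> s \<in> carrier S \<and> q \<in> carrier Q} \<union>
     {frag_of (k \<odot>\<^bsub>P\<^esub> p, q) - frag_of (p, k \<odot>\<^bsub>Q\<^esub> q) | p k q.
        p \<in> carrier P \<and> k \<in> carrier K \<and> q \<in> carrier Q}"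

definition tensor_null ::
    "'k ring \<Rightarrow> ('k, 's) module \<Rightarrow> ('k, 'l, 's, 'p, 'd) bimodule_scheme \<Rightarrow>
     ('k, 's, 'r, 'q, 'e) bimodule_scheme \<Rightarrow> ('p \<times> 'q \<Rightarrow>\<^sub>0 int) set" where
  "tensor_null K S P Q =
     generate (free_Abelian_group (carrier P \<times> carrier Q)) (tensor_relations K S P Q)"

text \<open>The pure tensor \<open>p \<otimes>\<^sub>S q\<close>.\<close>

definition tens ::
    "'k ring \<Rightarrow> ('k, 's) module \<Rightarrow> ('k, 'l, 's, 'p, 'd) bimodule_scheme \<Rightarrow>
     ('k, 's, 'r, 'q, 'e) bimodule_scheme \<Rightarrow> 'p \<Rightarrow> 'q \<Rightarrow> ('p, 'q) tensor_elem" where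
  "tens K S P Q p q =
     tensor_null K S P Q #>\<^bsub>free_Abelian_group (carrier P \<times> carrier Q)\<^esub> frag_of (p, q)"

text \<open>
  Sweedler sums: if \<open>X = \<Sum>\<^sub>i p\<^sub>i \<otimes> q\<^sub>i\<close>, then \<open>tsum G f X = \<Sum>\<^sub>i f p\<^sub>i q\<^sub>i\<close> in the abelian group \<open>G\<close>.  A
  representative of \<open>X\<close> is chosen; the value does not depend on it whenever \<open>f\<close> respects the
  relations of the tensor product, and then \<open>tsum G f\<close> is the additive map sending \<open>p \<otimes> q\<close> to \<open>f p q\<close>.
\<close>

definition tsum :: "('g, 'e) ring_scheme \<Rightarrow> ('p \<Rightarrow> 'q \<Rightarrow> 'g) \<Rightarrow> ('p, 'q) tensor_elem \<Rightarrow> 'g" where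
  "tsum G f X =
     (let c = (SOME c. c \<in> X)
      in finsum G (\<lambda>(p, q). [Poly_Mapping.lookup c (p, q)] \<cdot>\<^bsub>G\<^esub> f p q) (Poly_Mapping.keys c))"

definition tensor_group ::
    "'k ring \<Rightarrow> ('k, 's) module \<Rightarrow> ('k, 'l, 's, 'p, 'd) bimodule_scheme \<Rightarrow>
     ('k, 's, 'r, 'q, 'e) bimodule_scheme \<Rightarrow> ('p, 'q) tensor_elem ring" where
  "tensor_group K S P Q =
     (let F = free_Abelian_group (carrier P \<times> carrier Q) Mod tensor_null K S P Q
      in \<lparr>carrier = carrier F, monoid.mult = undefined, one = undefined,
          ring.zero = \<one>\<^bsub>F\<^esub>, ring.add = monoid.mult F\<rparr>)"

text \<open>The outer actions of \<open>P\<close> and \<open>Q\<close> are inherited by the tensor product.\<close>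

definition tensor ::
    "'k ring \<Rightarrow> ('k, 's) module \<Rightarrow> ('k, 'l, 's, 'p, 'd) bimodule_scheme \<Rightarrow>
     ('k, 's, 'r, 'q, 'e) bimodule_scheme \<Rightarrow> ('k, 'l, 'r, ('p, 'q) tensor_elem) bimodule" where
  "tensor K S P Q =
     (let T = tensor_group K S P Q
      in \<lparr>carrier = carrier T, monoid.mult = monoid.mult T, one = one T, ring.zero = ring.zero T,
          ring.add = ring.add T,
          smult = (\<lambda>k. tsum T (\<lambda>p q. tens K S P Q (k \<odot>\<^bsub>P\<^esub> p) q)),
          lact = (\<lambda>a. tsum T (\<lambda>p q. tens K S P Q (lact P a p) q)),
          ract = (\<lambda>X b. tsum T (\<lambda>p q. tens K S P Q p (ract Q q b)) X)\<rparr>)"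

text \<open>The map \<open>f \<otimes>\<^sub>S g : P \<otimes>\<^sub>S Q \<rightarrow> P' \<otimes>\<^sub>S Q'\<close>; only its codomain has to be given.\<close>

definition tensor_map ::
    "'k ring \<Rightarrow> ('k, 's) module \<Rightarrow> ('k, 'l, 's, 'p2, 'd) bimodule_scheme \<Rightarrow>
     ('k, 's, 'r, 'q2, 'e) bimodule_scheme \<Rightarrow> ('p \<Rightarrow> 'p2) \<Rightarrow> ('q \<Rightarrow> 'q2) \<Rightarrow>
     ('p, 'q) tensor_elem \<Rightarrow> ('p2, 'q2) tensor_elem" where
  "tensor_map K S P' Q' f g = tsum (tensor K S P' Q') (\<lambda>p q. tens K S P' Q' (f p) (g q))"

text \<open>The canonical map \<open>(P \<otimes>\<^sub>S Q) \<otimes>\<^sub>T V \<rightarrow> P \<otimes>\<^sub>S (Q \<otimes>\<^sub>T V)\<close>.\<close>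

definition tensor_assoc ::
    "'k ring \<Rightarrow> ('k, 's) module \<Rightarrow> ('k, 't) module \<Rightarrow> ('k, 'l, 's, 'p, 'd) bimodule_scheme \<Rightarrow>
     ('k, 's, 't, 'q, 'e) bimodule_scheme \<Rightarrow> ('k, 't, 'r, 'v, 'h) bimodule_scheme \<Rightarrow>
     (('p, 'q) tensor_elem, 'v) tensor_elem \<Rightarrow> ('p, ('q, 'v) tensor_elem) tensor_elem" where
  "tensor_assoc K S T P Q V =
     (let W = tensor K S P (tensor K T Q V)
      in tsum W (\<lambda>X v. tsum W (\<lambda>p q. tens K S P (tensor K T Q V) p (tens K T Q V q v)) X))"


section \<open>Firm rings and modules\<close>

definition firm_map :: "('k, 'l, 'r, 'm, 'e) bimodule_scheme \<Rightarrow> ('l, 'm) tensor_elem \<Rightarrow> 'm" where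
  "firm_map M = tsum M (\<lambda>r m. lact M r m)"

definition firm_module ::
    "'k ring \<Rightarrow> ('k, 'l) module \<Rightarrow> ('k, 'l, 'r, 'm, 'e) bimodule_scheme \<Rightarrow> bool" where
  "firm_module K R M \<longleftrightarrow> left_module K R M \<and>
     bij_betw (firm_map M) (carrier (tensor K R (regular R) M)) (carrier M)"

definition firm_ring :: "'k ring \<Rightarrow> ('k, 'r) module \<Rightarrow> bool" where
  "firm_ring K R \<longleftrightarrow> nonunital_algebra K R \<and>
     bij_betw (firm_map (regular R)) (carrier (tensor K R (regular R) (regular R))) (carrier R)"

text \<open>\<open>firm_inv K R M m = r \<otimes>\<^sub>R m\<^sup>r\<close>.\<close>

definition firm_inv ::
    "'k ring \<Rightarrow> ('k, 'l) module \<Rightarrow> ('k, 'l, 'r, 'm, 'e) bimodule_scheme \<Rightarrow>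
     'm \<Rightarrow> ('l, 'm) tensor_elem" where
  "firm_inv K R M = inv_into (carrier (tensor K R (regular R) M)) (firm_map M)"


section \<open>Corings and comodules\<close>

record ('k, 'a, 'c) coring = "('k, 'a, 'a, 'c) bimodule" +
  comult :: "'c \<Rightarrow> ('c, 'c) tensor_elem"
  counit :: "'c \<Rightarrow> 'a"

text \<open>
  In the counit axioms the canonical maps \<open>A \<otimes>\<^sub>A C \<rightarrow> C\<close> and \<open>C \<otimes>\<^sub>A A \<rightarrow> C\<close> have been absorbed into
  the Sweedler sums; likewise for comodules.
\<close>

locale coring = unital_bimodule K A C
  for K :: "'k ring" and A :: "('k, 'a) module" and C :: "('k, 'a, 'c) coring" +
  assumes comult_linear: "linear_map K C (tensor K A C C) (comult C)"
    and comult_left: "left_linear A C (tensor K A C C) (comult C)"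
    and comult_right: "right_linear A C (tensor K A C C) (comult C)"
    and counit_linear: "linear_map K C A (counit C)"
    and counit_left: "left_linear A C (regular A) (counit C)"
    and counit_right: "right_linear A C (regular A) (counit C)"
    and coassoc: "c \<in> carrier C \<Longrightarrow>
      tensor_assoc K A A C C C
        (tensor_map K A (tensor K A C C) C (comult C) (\<lambda>d. d) (comult C c)) =
      tensor_map K A C (tensor K A C C) (\<lambda>d. d) (comult C) (comult C c)"
    and counit_l: "c \<in> carrier C \<Longrightarrow> tsum C (\<lambda>c1 c2. lact C (counit C c1) c2) (comult C c) = c"
    and counit_r: "c \<in> carrier C \<Longrightarrow> tsum C (\<lambda>c1 c2. ract C c1 (counit C c2)) (comult C c) = c"

definition coring_hom ::
    "'k ring \<Rightarrow> ('k, 'a) module \<Rightarrow> ('k, 'a, 'c) coring \<Rightarrow> ('k, 'a, 'd) coring \<Rightarrow> ('c \<Rightarrow> 'd) \<Rightarrow> bool" where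
  "coring_hom K A C D f \<longleftrightarrow> coring K A C \<and> coring K A D \<and>
     linear_map K C D f \<and> left_linear A C D f \<and> right_linear A C D f \<and>
     (\<forall>c \<in> carrier C. comult D (f c) = tensor_map K A D D f f (comult C c)) \<and>
     (\<forall>c \<in> carrier C. counit D (f c) = counit C c)"

locale right_comodule = C: coring K A C + unital_right_module K A M
  for K :: "'k ring" and A :: "('k, 'a) module" and C :: "('k, 'a, 'c) coring"
    and M :: "('k, 'l, 'a, 'm) bimodule" and \<rho> :: "'m \<Rightarrow> ('m, 'c) tensor_elem" +
  assumes coaction_linear: "linear_map K M (tensor K A M C) \<rho>"
    and coaction_right: "right_linear A M (tensor K A M C) \<rho>"
    and coaction_coassoc: "u \<in> carrier M \<Longrightarrow>
      tensor_assoc K A A M C C (tensor_map K A (tensor K A M C) C \<rho> (\<lambda>c. c) (\<rho> u)) =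
      tensor_map K A M (tensor K A C C) (\<lambda>v. v) (comult C) (\<rho> u)"
    and coaction_counit: "u \<in> carrier M \<Longrightarrow> tsum M (\<lambda>v c. ract M v (counit C c)) (\<rho> u) = u"

locale bicomodule = right_comodule K A C M \<rho> + bimodule K R A M
  for K :: "'k ring" and R :: "('k, 'l) module" and A :: "('k, 'a) module"
    and C :: "('k, 'a, 'c) coring" and M :: "('k, 'l, 'a, 'm) bimodule"
    and \<rho> :: "'m \<Rightarrow> ('m, 'c) tensor_elem" +
  assumes coaction_left: "left_linear R M (tensor K A M C) \<rho>"


section \<open>The comatrix coring\<close>

text \<open>
  \<open>\<Sigma>\<^sup>* = Hom\<^sub>A(\<Sigma>, A)\<close>, with \<open>(a\<phi>)(u) = a\<phi>(u)\<close> and \<open>(\<phi>r)(u) = \<phi>(ru)\<close>.  Functions are extensional, so that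
  equality in the dual is equality of maps on \<open>\<Sigma>\<close>.  The right action matters only when \<open>\<Sigma>\<close> has a left
  action; right \<open>A\<close>-linearity entails \<open>K\<close>-linearity because \<open>\<Sigma>\<close> is unital over \<open>A\<close>.
\<close>

definition dual ::
    "('k, 'a) module \<Rightarrow> ('k, 'l, 'a, 's) bimodule \<Rightarrow> ('k, 'a, 'l, 's \<Rightarrow> 'a) bimodule" where
  "dual A \<Sigma> =
     \<lparr>carrier = {\<phi> \<in> carrier \<Sigma> \<rightarrow>\<^sub>E carrier A.
        (\<forall>u \<in> carrier \<Sigma>. \<forall>v \<in> carrier \<Sigma>. \<phi> (u \<oplus>\<^bsub>\<Sigma>\<^esub> v) = \<phi> u \<oplus>\<^bsub>A\<^esub> \<phi> v) \<and>
        right_linear A \<Sigma> (regular A) \<phi>},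
      monoid.mult = undefined, one = undefined,
      ring.zero = (\<lambda>u \<in> carrier \<Sigma>. \<zero>\<^bsub>A\<^esub>),
      ring.add = (\<lambda>\<phi> \<psi>. \<lambda>u \<in> carrier \<Sigma>. \<phi> u \<oplus>\<^bsub>A\<^esub> \<psi> u),
      smult = (\<lambda>k \<phi>. \<lambda>u \<in> carrier \<Sigma>. k \<odot>\<^bsub>A\<^esub> \<phi> u),
      lact = (\<lambda>a \<phi>. \<lambda>u \<in> carrier \<Sigma>. a \<otimes>\<^bsub>A\<^esub> \<phi> u),
      ract = (\<lambda>\<phi> r. \<lambda>u \<in> carrier \<Sigma>. \<phi> (lact \<Sigma> r u))\<rparr>"

text \<open>The algebra \<open>\<Sigma> \<otimes>\<^sub>A \<Sigma>\<^sup>*\<close> with \<open>(x \<otimes> \<phi>)(y \<otimes> \<psi>) = x\<phi>(y) \<otimes> \<psi>\<close>; it does not depend on \<open>lact \<Sigma>\<close> as an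
  algebra.\<close>

definition dual_tensor_algebra ::
    "'k ring \<Rightarrow> ('k, 'a) module \<Rightarrow> ('k, 'l, 'a, 's) bimodule \<Rightarrow>
     ('k, 'l, 'l, ('s, 's \<Rightarrow> 'a) tensor_elem) bimodule" where
  "dual_tensor_algebra K A \<Sigma> =
     (let T = tensor K A \<Sigma> (dual A \<Sigma>)
      in T\<lparr>monoid.mult := (\<lambda>X Y. tsum T (\<lambda>x \<phi>. tsum T (\<lambda>y \<psi>.
             tens K A \<Sigma> (dual A \<Sigma>) (ract \<Sigma> x (\<phi> y)) \<psi>) Y) X)\<rparr>)"

text \<open>\<open>r u = e\<^sub>r \<phi>\<^sub>r(u)\<close> where \<open>\<iota> r = e\<^sub>r \<otimes>\<^sub>A \<phi>\<^sub>r\<close>.\<close>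

definition induced_action ::
    "('k, 'l, 'a, 's) bimodule \<Rightarrow> ('r \<Rightarrow> ('s, 's \<Rightarrow> 'a) tensor_elem) \<Rightarrow> 'r \<Rightarrow> 's \<Rightarrow> 's" where
  "induced_action \<Sigma> \<iota> r u = tsum \<Sigma> (\<lambda>e \<phi>. ract \<Sigma> e (\<phi> u)) (\<iota> r)"

text \<open>
  For \<open>u\<close> in \<open>\<Sigma>\<close>, \<open>firm_inv K R \<Sigma> u = r \<otimes>\<^sub>R u\<^sup>r\<close>; then
  \<open>\<Delta>(\<phi> \<otimes>\<^sub>R u) = (\<phi> \<otimes>\<^sub>R e\<^sub>r) \<otimes>\<^sub>A (\<phi>\<^sub>r \<otimes>\<^sub>R u\<^sup>r)\<close> and \<open>\<epsilon>(\<phi> \<otimes>\<^sub>R u) = \<phi>(u)\<close>.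
\<close>

definition comatrix_coring ::
    "'k ring \<Rightarrow> ('k, 'r) module \<Rightarrow> ('k, 'a) module \<Rightarrow> ('k, 'r, 'a, 's) bimodule \<Rightarrow>
     ('r \<Rightarrow> ('s, 's \<Rightarrow> 'a) tensor_elem) \<Rightarrow> ('k, 'a, ('s \<Rightarrow> 'a, 's) tensor_elem) coring" where
  "comatrix_coring K R A \<Sigma> \<iota> =
     (let T = tensor K R (dual A \<Sigma>) \<Sigma>;
          TT = tensor K A T T;
          t = tens K R (dual A \<Sigma>) \<Sigma>
      in bimodule.extend T (coring.fields
           (tsum TT (\<lambda>\<phi> u. tsum TT (\<lambda>r v. tsum TT (\<lambda>e \<psi>. tens K A T T (t \<phi> e) (t \<psi> v)) (\<iota> r))
              (firm_inv K R \<Sigma> u)))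
           (tsum A (\<lambda>\<phi> u. \<phi> u))))"

definition can ::
    "('k, 'a, 'c) coring \<Rightarrow> ('s \<Rightarrow> ('s, 'c) tensor_elem) \<Rightarrow> ('s \<Rightarrow> 'a, 's) tensor_elem \<Rightarrow> 'c" where
  "can C \<rho> = tsum C (\<lambda>\<phi> x. tsum C (\<lambda>u c. lact C (\<phi> u) c) (\<rho> x))"

end

(* By firmness Sigma is spanned by the elements r v, so Sigma* (x)_R Sigma is spanned by the
   phi (x) r v, on which Delta is (phi (x) e_r) (x) (phi_r (x) v); this removes the inverse
   of R (x)_R Sigma -> Sigma from every later computation.  Likewise R is spanned by products
   r s, and iota(r s) = r iota(s) = iota(r) s turns both sides of coassociativity at
   phi (x) (r s) v into one double sum over iota(r) and iota(s), taken in the two possible orders.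
   For can and Delta, apply phi (x) C (x) C to the coassociativity of the coaction at r v and
   use that the coaction is R-linear. *)

theory Submission
  imports Defs
begin

section \<open>Additive and balanced maps\<close>

text \<open>An element of a tensor product is a coset, and \<open>tsum\<close> evaluates a
  representative picked by choice, so a Sweedler sum has meaning only once its summand is shown to
  be balanced. This shapes most arguments: establish balancedness, establish additivity of both
  sides, compare on pure tensors. Nested sums require in addition that a sum over one tensor stays
  balanced in the remaining variables.

  Products in R enter coassociativity because in (\<phi> \<otimes> e_r) \<otimes> (\<phi>_r
  \<otimes> v) neither e_r nor v is displayed as a multiple by an element of R, so neither leg can
  be comultiplied explicitly. With r \<iota>(s) the left leg becomes \<phi> \<otimes> r e_s; with
  \<iota>(r) s the right leg becomes, after balancing over R, \<phi>_r \<otimes> s v.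

  For the canonical map, R-linearity of the coaction produces r v_[0] = e_r \<phi>_r(v_[0]) in the
  first leg. The scalar \<phi>_r(v_[0]) then crosses the tensor sign over A and completes the second
  leg to the image of \<phi>_r \<otimes> v.\<close>

definition additive_map :: "('g, 'd) ring_scheme \<Rightarrow> ('h, 'e) ring_scheme \<Rightarrow> ('g \<Rightarrow> 'h) \<Rightarrow> bool" where
  "additive_map G H h \<longleftrightarrow> h \<in> carrier G \<rightarrow> carrier H \<and>
     (\<forall>x \<in> carrier G. \<forall>y \<in> carrier G. h (x \<oplus>\<^bsub>G\<^esub> y) = h x \<oplus>\<^bsub>H\<^esub> h y)"

lemma additive_mapI:
  assumes "\<And>x. x \<in> carrier G \<Longrightarrow> h x \<in> carrier H"
    and "\<And>x y. x \<in> carrier G \<Longrightarrow> y \<in> carrier G \<Longrightarrow> h (x \<oplus>\<^bsub>G\<^esub> y) = h x \<oplus>\<^bsub>H\<^esub> h y"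
  shows "additive_map G H h"
  using assms by (auto simp: additive_map_def)

lemma additive_map_closed: "additive_map G H h \<Longrightarrow> x \<in> carrier G \<Longrightarrow> h x \<in> carrier H"
  by (auto simp: additive_map_def)

lemma additive_map_add:
  "additive_map G H h \<Longrightarrow> x \<in> carrier G \<Longrightarrow> y \<in> carrier G \<Longrightarrow> h (x \<oplus>\<^bsub>G\<^esub> y) = h x \<oplus>\<^bsub>H\<^esub> h y"
  by (auto simp: additive_map_def)

lemma additive_map_compose:
  "additive_map G H h \<Longrightarrow> additive_map H J g \<Longrightarrow> additive_map G J (\<lambda>x. g (h x))"
  by (auto simp: additive_map_def Pi_iff)

lemma additive_map_sum:
  assumes "abelian_group H" "additive_map G H g" "additive_map G H h"
  shows "additive_map G H (\<lambda>x. g x \<oplus>\<^bsub>H\<^esub> h x)"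
proof -
  interpret H: abelian_group H by fact
  from assms(2,3) show ?thesis
    by (auto simp: additive_map_def Pi_iff H.a_ac)
qed

lemma linear_map_additive: "linear_map K M N f \<Longrightarrow> additive_map M N f"
  by (auto simp: linear_map_def additive_map_def)

text \<open>The target is merely an abelian group, matching a tensor product built as a quotient of
  a free abelian group. Balancing over \<open>K\<close> is a clause of its own because it does not
  follow from balancing over an \<open>S\<close> without unity.\<close>

definition balanced ::
    "'k ring \<Rightarrow> ('k, 's) module \<Rightarrow> ('k, 'l, 's, 'p, 'd) bimodule_scheme \<Rightarrow>
     ('k, 's, 'r, 'q, 'e) bimodule_scheme \<Rightarrow> ('g, 'h) ring_scheme \<Rightarrow> ('p \<Rightarrow> 'q \<Rightarrow> 'g) \<Rightarrow> bool" where
  "balanced K S P Q G f \<longleftrightarrow>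
     (\<forall>p \<in> carrier P. additive_map Q G (f p)) \<and>
     (\<forall>q \<in> carrier Q. additive_map P G (\<lambda>p. f p q)) \<and>
     (\<forall>p \<in> carrier P. \<forall>s \<in> carrier S. \<forall>q \<in> carrier Q. f (ract P p s) q = f p (lact Q s q)) \<and>
     (\<forall>p \<in> carrier P. \<forall>k \<in> carrier K. \<forall>q \<in> carrier Q. f (k \<odot>\<^bsub>P\<^esub> p) q = f p (k \<odot>\<^bsub>Q\<^esub> q))"

lemma balancedI:
  assumes "\<And>p q. p \<in> carrier P \<Longrightarrow> q \<in> carrier Q \<Longrightarrow> f p q \<in> carrier G"
    and "\<And>p p' q. p \<in> carrier P \<Longrightarrow> p' \<in> carrier P \<Longrightarrow> q \<in> carrier Q \<Longrightarrow>
      f (p \<oplus>\<^bsub>P\<^esub> p') q = f p q \<oplus>\<^bsub>G\<^esub> f p' q"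
    and "\<And>p q q'. p \<in> carrier P \<Longrightarrow> q \<in> carrier Q \<Longrightarrow> q' \<in> carrier Q \<Longrightarrow>
      f p (q \<oplus>\<^bsub>Q\<^esub> q') = f p q \<oplus>\<^bsub>G\<^esub> f p q'"
    and "\<And>p s q. p \<in> carrier P \<Longrightarrow> s \<in> carrier S \<Longrightarrow> q \<in> carrier Q \<Longrightarrow>
      f (ract P p s) q = f p (lact Q s q)"
    and "\<And>p k q. p \<in> carrier P \<Longrightarrow> k \<in> carrier K \<Longrightarrow> q \<in> carrier Q \<Longrightarrow>
      f (k \<odot>\<^bsub>P\<^esub> p) q = f p (k \<odot>\<^bsub>Q\<^esub> q)"
  shows "balanced K S P Q G f"
  using assms by (auto simp: balanced_def additive_map_def)

lemma balancedD:
  assumes "balanced K S P Q G f"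
  shows balanced_closed: "p \<in> carrier P \<Longrightarrow> q \<in> carrier Q \<Longrightarrow> f p q \<in> carrier G"
    and balanced_add_l: "p \<in> carrier P \<Longrightarrow> p' \<in> carrier P \<Longrightarrow> q \<in> carrier Q \<Longrightarrow>
      f (p \<oplus>\<^bsub>P\<^esub> p') q = f p q \<oplus>\<^bsub>G\<^esub> f p' q"
    and balanced_add_r: "p \<in> carrier P \<Longrightarrow> q \<in> carrier Q \<Longrightarrow> q' \<in> carrier Q \<Longrightarrow>
      f p (q \<oplus>\<^bsub>Q\<^esub> q') = f p q \<oplus>\<^bsub>G\<^esub> f p q'"
    and balanced_act: "p \<in> carrier P \<Longrightarrow> s \<in> carrier S \<Longrightarrow> q \<in> carrier Q \<Longrightarrow>
      f (ract P p s) q = f p (lact Q s q)"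
    and balanced_smult: "p \<in> carrier P \<Longrightarrow> k \<in> carrier K \<Longrightarrow> q \<in> carrier Q \<Longrightarrow>
      f (k \<odot>\<^bsub>P\<^esub> p) q = f p (k \<odot>\<^bsub>Q\<^esub> q)"
  using assms by (auto simp: balanced_def additive_map_def Pi_iff)

lemma balanced_compose:
  "balanced K S P Q G f \<Longrightarrow> additive_map G H h \<Longrightarrow> balanced K S P Q H (\<lambda>p q. h (f p q))"
  by (auto simp: balanced_def additive_map_def Pi_iff)

lemma balanced_sum:
  assumes "abelian_group G" "balanced K S P Q G f" "balanced K S P Q G g"
  shows "balanced K S P Q G (\<lambda>p q. f p q \<oplus>\<^bsub>G\<^esub> g p q)"
  using assms(2,3) by (auto simp: balanced_def intro: additive_map_sum[OF assms(1)])

section \<open>The universal property of the tensor product\<close>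

text \<open>The linear extension of \<open>g\<close> to formal integer combinations. Separating it
  from \<open>tsum\<close> allows additivity to be shown before cosets and choice come in.\<close>

definition frag_eval :: "('g, 'e) ring_scheme \<Rightarrow> ('x \<Rightarrow> 'g) \<Rightarrow> ('x \<Rightarrow>\<^sub>0 int) \<Rightarrow> 'g" where
  "frag_eval G g c = finsum G (\<lambda>x. [Poly_Mapping.lookup c x] \<cdot>\<^bsub>G\<^esub> g x) (Poly_Mapping.keys c)"

lemma tsum_frag_eval: "tsum G f X = frag_eval G (case_prod f) (SOME c. c \<in> X)"
  unfolding tsum_def frag_eval_def Let_def
  by (rule arg_cong2[where f = "finsum G"]) (auto simp: fun_eq_iff)

text \<open>A Sweedler sum sees only carrier, addition and zero of its target. This identifies sums
  in the bare \<open>tensor_group\<close>, where the actions are defined, with sums in the full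
  bimodule, and sums in a bimodule with sums in a record extending it.\<close>

lemma tsum_group_cong:
  assumes "carrier G = carrier H" "ring.add G = ring.add H" "\<zero>\<^bsub>G\<^esub> = \<zero>\<^bsub>H\<^esub>"
  shows "tsum G = tsum H"
proof -
  have "[n] \<cdot>\<^bsub>G\<^esub> x = [n] \<cdot>\<^bsub>H\<^esub> x" for n :: int and x
    by (simp add: assms add_pow_def int_pow_def nat_pow_def m_inv_def Let_def cong: if_cong)
  then show ?thesis
    by (intro ext) (simp add: assms tsum_def finsum_def finprod_def)
qed

section \<open>Evaluation of formal integer combinations\<close>

context abelian_group
begin

text \<open>Coefficients vanish off the support, so two formal sums with different supports can be
  evaluated over one common index set, as additivity requires.\<close>

lemma frag_eval_superset:
  assumes "finite B" "Poly_Mapping.keys c \<subseteq> B" "g \<in> B \<rightarrow> carrier G"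
  shows "frag_eval G g c = finsum G (\<lambda>x. [Poly_Mapping.lookup c x] \<cdot> g x) B"
  unfolding frag_eval_def
proof (rule add.finprod_mono_neutral_cong_left)
  show "\<And>i. i \<in> B - Poly_Mapping.keys c \<Longrightarrow> [Poly_Mapping.lookup c i] \<cdot> g i = \<zero>"
    by (simp add: in_keys_iff add_pow_def)
qed (use assms in auto)

lemma frag_eval_closed:
  assumes "Poly_Mapping.keys c \<subseteq> B" "g \<in> B \<rightarrow> carrier G"
  shows "frag_eval G g c \<in> carrier G"
  unfolding frag_eval_def using assms by (intro finsum_closed) auto

lemma frag_eval_add:
  assumes "Poly_Mapping.keys c \<subseteq> B" "Poly_Mapping.keys d \<subseteq> B" "g \<in> B \<rightarrow> carrier G"
  shows "frag_eval G g (c + d) = frag_eval G g c \<oplus> frag_eval G g d"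
proof -
  let ?B = "Poly_Mapping.keys c \<union> Poly_Mapping.keys d"
  have g: "g \<in> ?B \<rightarrow> carrier G" using assms by auto
  have "frag_eval G g (c + d) = finsum G (\<lambda>x. [Poly_Mapping.lookup (c + d) x] \<cdot> g x) ?B"
    using g by (intro frag_eval_superset) (auto dest: subsetD[OF keys_add])
  also have "\<dots> = finsum G (\<lambda>x. [Poly_Mapping.lookup c x] \<cdot> g x \<oplus> [Poly_Mapping.lookup d x] \<cdot> g x) ?B"
    using g by (intro add.finprod_cong') (auto simp: lookup_add Pi_iff intro!: add.int_pow_mult)
  also have "\<dots> = frag_eval G g c \<oplus> frag_eval G g d"
    using g by (subst finsum_addf) (auto simp: frag_eval_superset[of ?B])
  finally show ?thesis .
qed

lemma frag_eval_diff:
  assumes "Poly_Mapping.keys c \<subseteq> B" "Poly_Mapping.keys d \<subseteq> B" "g \<in> B \<rightarrow> carrier G"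
  shows "frag_eval G g (c - d) = frag_eval G g c \<ominus> frag_eval G g d"
proof -
  have cd: "Poly_Mapping.keys (c - d) \<subseteq> B"
    using keys_diff[of c d] assms by auto
  note cl = frag_eval_closed[OF assms(1,3)] frag_eval_closed[OF assms(2,3)]
    frag_eval_closed[OF cd assms(3)]
  have "frag_eval G g c = frag_eval G g (c - d) \<oplus> frag_eval G g d"
    using frag_eval_add[OF cd assms(2,3)] by simp
  then show ?thesis
    using cl by (simp add: a_minus_def a_assoc r_neg)
qed

lemma frag_eval_frag_of: "g x \<in> carrier G \<Longrightarrow> frag_eval G g (frag_of x) = g x"
  by (simp add: frag_eval_def finsum_singleton)

end

text \<open>Only the two actions that meet in the middle are present: they determine the tensor
  product as a \<open>K\<close>-module. The outer actions join in
  \<open>tensor_bimodule\<close>.\<close>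

locale tensor_pair = P: right_module K S P + Q: left_module K S Q
  for K :: "'k ring" and S :: "('k, 's) module"
    and P :: "('k, 'l, 's, 'p, 'd) bimodule_scheme" and Q :: "('k, 's, 'r, 'q, 'e) bimodule_scheme"
begin

section \<open>The tensor product as a quotient of a free abelian group\<close>

abbreviation "F \<equiv> free_Abelian_group (carrier P \<times> carrier Q)"
abbreviation "N \<equiv> tensor_null K S P Q"
abbreviation "T \<equiv> tensor K S P Q"
abbreviation "t \<equiv> tens K S P Q"

lemma relations_carrier: "tensor_relations K S P Q \<subseteq> carrier F"
  unfolding tensor_relations_def
  by (auto dest!: subsetD[OF keys_diff] simp: P.ract_closed Q.lact_closed)

lemma null_subgroup: "subgroup N F"
  unfolding tensor_null_def by (intro group.generate_is_subgroup relations_carrier) simp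

lemma null_normal: "N \<lhd> F"
  using comm_group.normal_iff_subgroup[OF abelian_free_Abelian_group] null_subgroup by blast

lemma tensor_simps:
  "carrier T = carrier (F Mod N)" "ring.add T = monoid.mult (F Mod N)" "\<zero>\<^bsub>T\<^esub> = \<one>\<^bsub>F Mod N\<^esub>"
  by (simp_all add: tensor_def tensor_group_def Let_def)

lemma carrier_tensor: "carrier T = (\<lambda>c. N #>\<^bsub>F\<^esub> c) ` carrier F"
  by (simp add: tensor_simps carrier_FactGroup)

lemma tsum_tensor_group: "tsum (tensor_group K S P Q) = tsum T"
  by (rule tsum_group_cong) (simp_all add: tensor_def tensor_group_def Let_def)

sublocale T: abelian_group T
proof -
  interpret FN: comm_group "F Mod N"
    using comm_group.abelian_FactGroup[OF abelian_free_Abelian_group null_subgroup] .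
  \<comment> \<open>The operations of the quotient are kept folded so that the group laws known for
    \<open>F Mod N\<close> apply to them.\<close>
  show "abelian_group T"
    by (rule abelian_groupI)
      (simp_all add: tensor_simps FN.m_ac FN.l_inv_ex
        del: mult_FactGroup one_FactGroup)
qed

lemma add_cosets:
  assumes "c \<in> carrier F" "d \<in> carrier F"
  shows "(N #>\<^bsub>F\<^esub> c) \<oplus>\<^bsub>T\<^esub> (N #>\<^bsub>F\<^esub> d) = N #>\<^bsub>F\<^esub> (c + d)"
  using normal.rcos_sum[OF null_normal assms] by (simp add: tensor_simps)

lemma coset_zero: "N #>\<^bsub>F\<^esub> 0 = \<zero>\<^bsub>T\<^esub>"
  using group.coset_mult_one[OF group_free_Abelian_group subgroup.subset[OF null_subgroup]]
  by (simp add: tensor_simps)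

lemma coset_eqI:
  assumes "c \<in> carrier F" "d \<in> carrier F" "c - d \<in> N"
  shows "N #>\<^bsub>F\<^esub> c = N #>\<^bsub>F\<^esub> d"
proof -
  have "N #>\<^bsub>F\<^esub> (c - d) = N"
    using group.coset_join2[OF group_free_Abelian_group _ null_subgroup assms(3)]
      subgroup.mem_carrier[OF null_subgroup assms(3)] by blast
  moreover have "N #>\<^bsub>F\<^esub> (c - d) #>\<^bsub>F\<^esub> d = N #>\<^bsub>F\<^esub> c"
    using group.coset_mult_assoc[OF group_free_Abelian_group, of N _ "c - d" d]
      assms subgroup.subset[OF null_subgroup] subgroup.mem_carrier[OF null_subgroup assms(3)]
    by simp
  ultimately show ?thesis by simp
qed

lemma tens_closed [simp, intro]: "p \<in> carrier P \<Longrightarrow> q \<in> carrier Q \<Longrightarrow> t p q \<in> carrier T"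
  by (auto simp: carrier_tensor tens_def)

lemma null_relation: "c \<in> tensor_relations K S P Q \<Longrightarrow> c \<in> N"
  unfolding tensor_null_def by (rule generate.incl)

lemma tens_add_l:
  assumes "p \<in> carrier P" "p' \<in> carrier P" "q \<in> carrier Q"
  shows "t (p \<oplus>\<^bsub>P\<^esub> p') q = t p q \<oplus>\<^bsub>T\<^esub> t p' q"
proof -
  have "frag_of (p \<oplus>\<^bsub>P\<^esub> p', q) - (frag_of (p, q) + frag_of (p', q)) \<in> N"
    by (rule null_relation) (use assms in \<open>auto simp: tensor_relations_def diff_diff_eq\<close>)
  then show ?thesis
    using assms by (simp add: tens_def add_cosets coset_eqI subset_trans[OF keys_add])
qed

lemma tens_add_r:
  assumes "p \<in> carrier P" "q \<in> carrier Q" "q' \<in> carrier Q"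
  shows "t p (q \<oplus>\<^bsub>Q\<^esub> q') = t p q \<oplus>\<^bsub>T\<^esub> t p q'"
proof -
  have "frag_of (p, q \<oplus>\<^bsub>Q\<^esub> q') - (frag_of (p, q) + frag_of (p, q')) \<in> N"
    by (rule null_relation) (use assms in \<open>auto simp: tensor_relations_def diff_diff_eq\<close>)
  then show ?thesis
    using assms by (simp add: tens_def add_cosets coset_eqI subset_trans[OF keys_add])
qed

lemma tens_act:
  assumes "p \<in> carrier P" "s \<in> carrier S" "q \<in> carrier Q"
  shows "t (ract P p s) q = t p (lact Q s q)"
proof -
  have "frag_of (ract P p s, q) - frag_of (p, lact Q s q) \<in> N"
    by (rule null_relation) (use assms in \<open>auto simp: tensor_relations_def\<close>)
  then show ?thesis
    using assms by (simp add: tens_def coset_eqI P.ract_closed Q.lact_closed)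
qed

lemma tens_smult:
  assumes "p \<in> carrier P" "k \<in> carrier K" "q \<in> carrier Q"
  shows "t (k \<odot>\<^bsub>P\<^esub> p) q = t p (k \<odot>\<^bsub>Q\<^esub> q)"
proof -
  have "frag_of (k \<odot>\<^bsub>P\<^esub> p, q) - frag_of (p, k \<odot>\<^bsub>Q\<^esub> q) \<in> N"
    by (rule null_relation) (use assms in \<open>auto simp: tensor_relations_def\<close>)
  then show ?thesis
    using assms by (simp add: tens_def coset_eqI)
qed

text \<open>Existence in the universal property: a balanced map kills each generating relation, and
  by additivity of the evaluation it kills the subgroup they generate.\<close>

lemma frag_eval_null:
  assumes "abelian_group G" and f: "balanced K S P Q G f" and "c \<in> N"
  shows "frag_eval G (case_prod f) c = \<zero>\<^bsub>G\<^esub>"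
proof -
  interpret G: abelian_group G by fact
  let ?g = "case_prod f"
  have g: "?g \<in> carrier P \<times> carrier Q \<rightarrow> carrier G"
    using balanced_closed[OF f] by auto
  have diff: "frag_eval G ?g (c - d) = frag_eval G ?g c \<ominus>\<^bsub>G\<^esub> frag_eval G ?g d"
    if "c \<in> carrier F" "d \<in> carrier F" for c d
    using that by (intro G.frag_eval_diff[OF _ _ g]) auto
  have of: "frag_eval G ?g (frag_of (p, q)) = f p q" if "p \<in> carrier P" "q \<in> carrier Q" for p q
    using that balanced_closed[OF f] by (subst G.frag_eval_frag_of) simp_all
  have zero: "frag_eval G ?g 0 = \<zero>\<^bsub>G\<^esub>"
    by (simp add: frag_eval_def)
  \<comment> \<open>The shape (x + y) - x - y that both additivity relations take after evaluation
    and reassociation.\<close>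
  have comm: "x \<oplus>\<^bsub>G\<^esub> (y \<oplus>\<^bsub>G\<^esub> (\<ominus>\<^bsub>G\<^esub> x \<oplus>\<^bsub>G\<^esub> \<ominus>\<^bsub>G\<^esub> y)) = \<zero>\<^bsub>G\<^esub>"
    if "x \<in> carrier G" "y \<in> carrier G" for x y
    using that by (simp add: G.minus_add[symmetric] G.a_assoc[symmetric] G.r_neg)
  have rel: "frag_eval G ?g c = \<zero>\<^bsub>G\<^esub>" if "c \<in> tensor_relations K S P Q" for c
    using that balancedD[OF f] unfolding tensor_relations_def
    by (auto simp: diff of subset_trans[OF keys_diff] P.ract_closed Q.lact_closed a_minus_def
        G.a_assoc G.r_neg comm)
  have "c \<in> generate F (tensor_relations K S P Q)"
    using assms(3) by (simp add: tensor_null_def)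
  then show ?thesis
  proof induction
    case one
    then show ?case by (simp add: zero)
  next
    case (incl h)
    then show ?case by (rule rel)
  next
    case (inv h)
    then have h: "h \<in> carrier F" using relations_carrier by blast
    \<comment> \<open>The inverse is written as a difference, the form in which evaluation is
      already known to be compatible.\<close>
    then have "frag_eval G ?g (0 - h) = \<zero>\<^bsub>G\<^esub>"
      using diff[of 0 h] rel[OF inv] zero by (simp add: a_minus_def)
    then show ?case using h by simp
  next
    case (eng h1 h2)
    then have "h1 \<in> carrier F" "h2 \<in> carrier F"
      using null_subgroup[unfolded tensor_null_def] by (blast intro: subgroup.mem_carrier)+
    then show ?case
      using eng G.frag_eval_add[OF _ _ g, of h1 h2] by simp
  qed
qed

text \<open>Independence of the chosen representative: it differs from \<open>c\<close> by an
  element of \<open>N\<close>, on which the evaluation vanishes.\<close>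

lemma tsum_coset:
  assumes "abelian_group G" and f: "balanced K S P Q G f" and c: "c \<in> carrier F"
  shows "tsum G f (N #>\<^bsub>F\<^esub> c) = frag_eval G (case_prod f) c"
proof -
  interpret G: abelian_group G by fact
  have g: "case_prod f \<in> carrier P \<times> carrier Q \<rightarrow> carrier G"
    using balanced_closed[OF f] by auto
  define d where "d = (SOME d. d \<in> N #>\<^bsub>F\<^esub> c)"
  have "c \<in> N #>\<^bsub>F\<^esub> c"
    using c null_subgroup by (rule group.rcos_self[OF group_free_Abelian_group])
  then have "d \<in> N #>\<^bsub>F\<^esub> c"
    unfolding d_def by (rule someI)
  then obtain n where n: "n \<in> N" and d: "d = n + c"
    by (auto simp: r_coset_def)
  have "n \<in> carrier F" using n null_subgroup by (rule subgroup.mem_carrier[rotated])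
  then have "frag_eval G (case_prod f) d = frag_eval G (case_prod f) c"
    using c G.frag_eval_add[OF _ _ g, of n c] G.frag_eval_closed[OF _ g, of c]
    by (simp add: d frag_eval_null[OF assms(1) f n])
  then show ?thesis
    by (simp add: tsum_frag_eval d_def)
qed

lemma tsum_tens:
  assumes "abelian_group G" and f: "balanced K S P Q G f" and "p \<in> carrier P" "q \<in> carrier Q"
  shows "tsum G f (t p q) = f p q"
  using assms balanced_closed[OF f]
  by (simp add: tens_def tsum_coset abelian_group.frag_eval_frag_of)

lemma tsum_additive:
  assumes "abelian_group G" and f: "balanced K S P Q G f"
  shows "additive_map T G (tsum G f)"
proof (rule additive_mapI)
  interpret G: abelian_group G by fact
  have g: "case_prod f \<in> carrier P \<times> carrier Q \<rightarrow> carrier G"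
    using balanced_closed[OF f] by auto
  fix X assume "X \<in> carrier T"
  then obtain c where c: "c \<in> carrier F" "X = N #>\<^bsub>F\<^esub> c" by (auto simp: carrier_tensor)
  then show "tsum G f X \<in> carrier G"
    using G.frag_eval_closed[OF _ g] by (auto simp: tsum_coset[OF assms])
  fix Y assume "Y \<in> carrier T"
  then obtain d where d: "d \<in> carrier F" "Y = N #>\<^bsub>F\<^esub> d" by (auto simp: carrier_tensor)
  have "c + d \<in> carrier F"
    using c d by (auto dest: subsetD[OF keys_add])
  then show "tsum G f (X \<oplus>\<^bsub>T\<^esub> Y) = tsum G f X \<oplus>\<^bsub>G\<^esub> tsum G f Y"
    unfolding c d using c d add_cosets[OF c(1) d(1)] G.frag_eval_add[OF _ _ g, of c d]
    by (simp add: tsum_coset[OF assms])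
qed

text \<open>Both sides evaluate the same chosen representative, whose support lies in the carriers.
  Summands can therefore be rewritten pairwise, even before they are known to be balanced.\<close>

lemma tsum_cong:
  assumes "abelian_group G" "X \<in> carrier T"
    and "\<And>p q. p \<in> carrier P \<Longrightarrow> q \<in> carrier Q \<Longrightarrow> f p q = g p q"
    and "\<And>p q. p \<in> carrier P \<Longrightarrow> q \<in> carrier Q \<Longrightarrow> g p q \<in> carrier G"
  shows "tsum G f X = tsum G g X"
proof -
  interpret G: abelian_group G by fact
  define c where "c = (SOME c. c \<in> X)"
  obtain d where d: "d \<in> carrier F" "X = N #>\<^bsub>F\<^esub> d" using assms(2) by (auto simp: carrier_tensor)
  have "d \<in> X"
    unfolding d using d(1) null_subgroup by (rule group.rcos_self[OF group_free_Abelian_group])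
  then have "c \<in> X"
    unfolding c_def by (rule someI)
  moreover have "X \<subseteq> carrier F"
    unfolding d(2) using d(1)
    by (intro monoid.r_coset_subset_G[OF group.is_monoid] subgroup.subset[OF null_subgroup]) simp_all
  ultimately have "c \<in> carrier F" by blast
  then have c: "Poly_Mapping.keys c \<subseteq> carrier P \<times> carrier Q" by simp
  show ?thesis
    unfolding tsum_frag_eval frag_eval_def c_def[symmetric]
    by (rule G.add.finprod_cong') (use c assms(3,4) in auto)
qed

text \<open>Negatives need no separate case because \<open>- (p \<otimes> q) = (- p) \<otimes> q\<close>.\<close>

lemma tensor_induct [consumes 1, case_names tens add]:
  assumes "X \<in> carrier T"
    and tens: "\<And>p q. p \<in> carrier P \<Longrightarrow> q \<in> carrier Q \<Longrightarrow> Pr (t p q)"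
    and add: "\<And>X Y. X \<in> carrier T \<Longrightarrow> Y \<in> carrier T \<Longrightarrow> Pr X \<Longrightarrow> Pr Y \<Longrightarrow> Pr (X \<oplus>\<^bsub>T\<^esub> Y)"
  shows "Pr X"
proof -
  have zero: "t \<zero>\<^bsub>P\<^esub> q = \<zero>\<^bsub>T\<^esub>" if "q \<in> carrier Q" for q
    using tens_add_l[of "\<zero>\<^bsub>P\<^esub>" "\<zero>\<^bsub>P\<^esub>" q] that
    by (metis P.M.l_zero P.M.zero_closed T.add.l_cancel_one' tens_closed)
  have neg: "Pr (N #>\<^bsub>F\<^esub> (- frag_of (p, q)))" if "p \<in> carrier P" "q \<in> carrier Q" for p q
  proof -
    have "(N #>\<^bsub>F\<^esub> (- frag_of (p, q))) \<oplus>\<^bsub>T\<^esub> t p q = \<zero>\<^bsub>T\<^esub>"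
      using that by (simp add: tens_def add_cosets coset_zero)
    moreover have "t (\<ominus>\<^bsub>P\<^esub> p) q \<oplus>\<^bsub>T\<^esub> t p q = \<zero>\<^bsub>T\<^esub>"
      using that tens_add_l[of "\<ominus>\<^bsub>P\<^esub> p" p q] zero by (simp add: P.M.l_neg)
    moreover have "N #>\<^bsub>F\<^esub> (- frag_of (p, q)) \<in> carrier T"
      using that by (auto simp: carrier_tensor)
    ultimately have "N #>\<^bsub>F\<^esub> (- frag_of (p, q)) = t (\<ominus>\<^bsub>P\<^esub> p) q"
      using that by (metis P.M.a_inv_closed T.add.right_cancel tens_closed)
    then show ?thesis using tens that by simp
  qed
  obtain c where c: "c \<in> carrier F" "X = N #>\<^bsub>F\<^esub> c" using assms(1) by (auto simp: carrier_tensor)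
  show ?thesis
  proof -
    \<comment> \<open>The induction on the free abelian group is closed under differences, so the
      claim is carried for \<open>c\<close> and \<open>- c\<close> together.\<close>
    have "Pr (N #>\<^bsub>F\<^esub> c) \<and> Pr (N #>\<^bsub>F\<^esub> (- c))"
      using c(1)[unfolded carrier_free_Abelian_group_iff]
    proof (induction c rule: free_Abelian_group_induct[consumes 1])
      case 1
      have "Pr (t \<zero>\<^bsub>P\<^esub> \<zero>\<^bsub>Q\<^esub>)" by (intro tens) auto
      then show ?case by (simp add: zero coset_zero)
    next
      case (2 x y)
      have mem: "N #>\<^bsub>F\<^esub> z \<in> carrier T" if "Poly_Mapping.keys z \<subseteq> carrier P \<times> carrier Q" for z
        using that by (auto simp: carrier_tensor)
      have "Pr ((N #>\<^bsub>F\<^esub> x) \<oplus>\<^bsub>T\<^esub> (N #>\<^bsub>F\<^esub> (- y)))" "Pr ((N #>\<^bsub>F\<^esub> y) \<oplus>\<^bsub>T\<^esub> (N #>\<^bsub>F\<^esub> (- x)))"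
        using 2 by (auto intro!: add mem)
      then show ?case using 2 by (simp add: add_cosets)
    next
      case (3 a)
      then show ?case using tens neg by (auto simp: tens_def)
    qed
    then show ?thesis using c by simp
  qed
qed

lemma tensor_ext:
  assumes "additive_map T G g" "additive_map T G h"
    and "\<And>p q. p \<in> carrier P \<Longrightarrow> q \<in> carrier Q \<Longrightarrow> g (t p q) = h (t p q)" and "X \<in> carrier T"
  shows "g X = h X"
  using assms(4)
  by (induction rule: tensor_induct) (simp_all add: assms(3) additive_map_add[OF assms(1)]
      additive_map_add[OF assms(2)])

text \<open>Uniqueness in the universal property: a Sweedler sum is computed by exhibiting any
  additive map with the right values on pure tensors.\<close>

lemma tsum_eqI:
  assumes "abelian_group G" "balanced K S P Q G f" "additive_map T G h" "X \<in> carrier T"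
    and "\<And>p q. p \<in> carrier P \<Longrightarrow> q \<in> carrier Q \<Longrightarrow> h (t p q) = f p q"
  shows "tsum G f X = h X"
  by (rule tensor_ext[OF tsum_additive[OF assms(1,2)] assms(3) _ assms(4)])
    (simp add: tsum_tens[OF assms(1,2)] assms(5))

lemma additive_tsum:
  assumes "abelian_group G" "abelian_group H" "balanced K S P Q G f" "additive_map G H h"
    "X \<in> carrier T"
  shows "h (tsum G f X) = tsum H (\<lambda>p q. h (f p q)) X"
  by (rule tsum_eqI[symmetric, OF assms(2) balanced_compose[OF assms(3,4)]
        additive_map_compose[OF tsum_additive[OF assms(1,3)] assms(4)] assms(5)])
    (simp add: tsum_tens[OF assms(1,3)])

lemma tsum_sum:
  assumes "abelian_group G" "balanced K S P Q G f" "balanced K S P Q G g" "X \<in> carrier T"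
  shows "tsum G (\<lambda>p q. f p q \<oplus>\<^bsub>G\<^esub> g p q) X = tsum G f X \<oplus>\<^bsub>G\<^esub> tsum G g X"
  by (rule tsum_eqI[OF assms(1) balanced_sum[OF assms(1-3)] additive_map_sum[OF assms(1)
          tsum_additive[OF assms(1,2)] tsum_additive[OF assms(1,3)]] assms(4)])
    (simp add: tsum_tens[OF assms(1,2)] tsum_tens[OF assms(1,3)])

section \<open>Tensor products of bimodules\<close>

lemma smult_tensor: "k \<odot>\<^bsub>T\<^esub> X = tsum T (\<lambda>p q. t (k \<odot>\<^bsub>P\<^esub> p) q) X"
  unfolding tsum_tensor_group[symmetric] by (simp add: tensor_def Let_def)

lemma lact_tensor: "lact T a X = tsum T (\<lambda>p q. t (lact P a p) q) X"
  unfolding tsum_tensor_group[symmetric] by (simp add: tensor_def Let_def)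

lemma ract_tensor: "ract T X b = tsum T (\<lambda>p q. t p (ract Q q b)) X"
  unfolding tsum_tensor_group[symmetric] by (simp add: tensor_def Let_def)

lemma smult_balanced:
  assumes "k \<in> carrier K"
  shows "balanced K S P Q T (\<lambda>p q. t (k \<odot>\<^bsub>P\<^esub> p) q)"
proof (rule balancedI)
  fix p k' q assume "p \<in> carrier P" "k' \<in> carrier K" "q \<in> carrier Q"
  moreover from this have "k \<odot>\<^bsub>P\<^esub> (k' \<odot>\<^bsub>P\<^esub> p) = k' \<odot>\<^bsub>P\<^esub> (k \<odot>\<^bsub>P\<^esub> p)"
    using assms by (metis P.S.R.m_comm P.M.smult_assoc1)
  ultimately show "t (k \<odot>\<^bsub>P\<^esub> (k' \<odot>\<^bsub>P\<^esub> p)) q = t (k \<odot>\<^bsub>P\<^esub> p) (k' \<odot>\<^bsub>Q\<^esub> q)"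
    using assms by (simp add: tens_smult)
qed (use assms in \<open>simp_all add: P.M.smult_r_distr tens_add_l tens_add_r P.ract_smult_l[symmetric]
      tens_act P.ract_closed\<close>)

lemma smult_tens [simp]:
  "k \<in> carrier K \<Longrightarrow> p \<in> carrier P \<Longrightarrow> q \<in> carrier Q \<Longrightarrow> k \<odot>\<^bsub>T\<^esub> t p q = t (k \<odot>\<^bsub>P\<^esub> p) q"
  unfolding smult_tensor by (rule tsum_tens[OF T.abelian_group_axioms smult_balanced])

lemma smult_additive: "k \<in> carrier K \<Longrightarrow> additive_map T T (\<lambda>X. k \<odot>\<^bsub>T\<^esub> X)"
  unfolding smult_tensor by (rule tsum_additive[OF T.abelian_group_axioms smult_balanced])

lemmas smult_closed = additive_map_closed[OF smult_additive]
lemmas smult_add = additive_map_add[OF smult_additive]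

sublocale T: module K T
proof (rule moduleI)
  fix a b x y assume a: "a \<in> carrier K" and b: "b \<in> carrier K" and x: "x \<in> carrier T"
  show "(a \<oplus>\<^bsub>K\<^esub> b) \<odot>\<^bsub>T\<^esub> x = a \<odot>\<^bsub>T\<^esub> x \<oplus>\<^bsub>T\<^esub> b \<odot>\<^bsub>T\<^esub> x"
    using x by (induction rule: tensor_induct)
      (use a b in \<open>simp_all add: P.M.smult_l_distr tens_add_l smult_add smult_closed T.a_ac\<close>)
  show "(a \<otimes>\<^bsub>K\<^esub> b) \<odot>\<^bsub>T\<^esub> x = a \<odot>\<^bsub>T\<^esub> (b \<odot>\<^bsub>T\<^esub> x)"
    using x by (induction rule: tensor_induct)
      (use a b in \<open>simp_all add: P.M.smult_assoc1 smult_add smult_closed\<close>)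
next
  fix x assume "x \<in> carrier T"
  then show "\<one>\<^bsub>K\<^esub> \<odot>\<^bsub>T\<^esub> x = x"
    by (induction rule: tensor_induct) (simp_all add: smult_add)
qed (simp_all add: smult_closed smult_add P.S.R.cring_axioms T.abelian_group_axioms)

text \<open>Here the tensor is fixed and the summand varies. The summand at a sum of parameters is
  split pair by pair under the same representative, and \<open>tsum_sum\<close> then separates the
  two balanced pieces.\<close>

lemma additive_tsum_param:
  assumes G: "abelian_group G" and add: "\<And>p q. p \<in> carrier P \<Longrightarrow> q \<in> carrier Q \<Longrightarrow> additive_map V G (\<lambda>v. h v p q)"
    and bal: "\<And>v. v \<in> carrier V \<Longrightarrow> balanced K S P Q G (h v)" and X: "X \<in> carrier T"
  shows "additive_map V G (\<lambda>v. tsum G (h v) X)"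
proof (rule additive_mapI)
  interpret G: abelian_group G by fact
  show "tsum G (h v) X \<in> carrier G" if "v \<in> carrier V" for v
    using additive_map_closed[OF tsum_additive[OF G bal[OF that]] X] .
  fix v w assume v: "v \<in> carrier V" and w: "w \<in> carrier V"
  have "tsum G (h (v \<oplus>\<^bsub>V\<^esub> w)) X = tsum G (\<lambda>p q. h v p q \<oplus>\<^bsub>G\<^esub> h w p q) X"
    by (rule tsum_cong[OF G X])
      (simp_all add: v w additive_map_add[OF add] balanced_closed[OF bal] G.a_closed)
  then show "tsum G (h (v \<oplus>\<^bsub>V\<^esub> w)) X = tsum G (h v) X \<oplus>\<^bsub>G\<^esub> tsum G (h w) X"
    using tsum_sum[OF G bal[OF v] bal[OF w] X] by simp
qed

end

text \<open>What makes nested Sweedler sums legitimate: after summing over \<open>X\<close>, the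
  remaining pair must again be balanced. Its action and scalar relations hold summand by summand,
  and additivity is the preceding parameter argument.\<close>

lemma tsum_param_balanced:
  assumes "tensor_pair K S P Q" and G: "abelian_group G"
    and h: "\<And>x y. x \<in> carrier P' \<Longrightarrow> y \<in> carrier Q' \<Longrightarrow> balanced K S P Q G (h x y)"
    and h': "\<And>p q. p \<in> carrier P \<Longrightarrow> q \<in> carrier Q \<Longrightarrow> balanced K S' P' Q' G (\<lambda>x y. h x y p q)"
    and X: "X \<in> carrier (tensor K S P Q)"
    and P': "right_module K S' P'" and Q': "left_module K S' Q'"
  shows "balanced K S' P' Q' G (\<lambda>x y. tsum G (h x y) X)"
proof -
  interpret tensor_pair K S P Q by fact
  interpret P': right_module K S' P' by fact
  interpret Q': left_module K S' Q' by fact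
  have cong: "tsum G (h x y) X = tsum G (h x' y') X"
    if "x' \<in> carrier P'" "y' \<in> carrier Q'"
      "\<And>p q. p \<in> carrier P \<Longrightarrow> q \<in> carrier Q \<Longrightarrow> h x y p q = h x' y' p q" for x y x' y'
    by (rule tsum_cong[OF G X that(3) balanced_closed[OF h[OF that(1,2)]]])
  show ?thesis
    unfolding balanced_def
  proof (intro conjI ballI)
    show "additive_map Q' G (\<lambda>y. tsum G (h x y) X)" if "x \<in> carrier P'" for x
      by (rule additive_tsum_param[OF G _ h[OF that] X])
        (use h' that in \<open>simp add: balanced_def\<close>)
    show "additive_map P' G (\<lambda>x. tsum G (h x y) X)" if "y \<in> carrier Q'" for y
      by (rule additive_tsum_param[OF G _ h[OF _ that] X])
        (use h' that in \<open>simp_all add: balanced_def\<close>)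
    fix x y assume x: "x \<in> carrier P'" and y: "y \<in> carrier Q'"
    show "tsum G (h (ract P' x s) y) X = tsum G (h x (lact Q' s y)) X" if s: "s \<in> carrier S'" for s
      by (rule cong[OF x Q'.lact_closed[OF s y] balanced_act[OF h' x s y]])
    show "tsum G (h (k \<odot>\<^bsub>P'\<^esub> x) y) X = tsum G (h x (k \<odot>\<^bsub>Q'\<^esub> y)) X" if k: "k \<in> carrier K" for k
      by (rule cong[OF x Q'.M.smult_closed[OF k y] balanced_smult[OF h' x k y]])
  qed
qed

text \<open>A Fubini rule. Both sides are additive in \<open>Y\<close>, so \<open>Y\<close> may be
  taken to be a pure tensor, where the sum over \<open>Y\<close> collapses; \<open>X\<close> stays
  arbitrary throughout.\<close>

lemma tsum_swap:
  assumes "tensor_pair K S P Q" "tensor_pair K S' P' Q'" and G: "abelian_group G"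
    and h: "\<And>x y. x \<in> carrier P' \<Longrightarrow> y \<in> carrier Q' \<Longrightarrow> balanced K S P Q G (\<lambda>p q. h p q x y)"
    and h': "\<And>p q. p \<in> carrier P \<Longrightarrow> q \<in> carrier Q \<Longrightarrow> balanced K S' P' Q' G (h p q)"
    and X: "X \<in> carrier (tensor K S P Q)" and Y: "Y \<in> carrier (tensor K S' P' Q')"
  shows "tsum G (\<lambda>p q. tsum G (h p q) Y) X = tsum G (\<lambda>x y. tsum G (\<lambda>p q. h p q x y) X) Y"
proof -
  interpret X: tensor_pair K S P Q by fact
  interpret Y: tensor_pair K S' P' Q' by fact
  have pY: "balanced K S P Q G (\<lambda>p q. tsum G (h p q) Z)" if "Z \<in> carrier Y.T" for Z
    by (rule tsum_param_balanced[OF assms(2) G h' h that X.P.right_module_axioms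
          X.Q.left_module_axioms])
  have pX: "balanced K S' P' Q' G (\<lambda>x y. tsum G (\<lambda>p q. h p q x y) X)"
    by (rule tsum_param_balanced[OF assms(1) G h h' X Y.P.right_module_axioms
          Y.Q.left_module_axioms])
  show ?thesis
  proof (rule Y.tsum_eqI[OF G pX _ Y, symmetric])
    show "additive_map Y.T G (\<lambda>Y. tsum G (\<lambda>p q. tsum G (h p q) Y) X)"
      by (rule X.additive_tsum_param[OF G Y.tsum_additive[OF G h'] pY X])
    show "tsum G (\<lambda>p q. tsum G (h p q) (Y.t x y)) X = tsum G (\<lambda>p q. h p q x y) X"
      if "x \<in> carrier P'" "y \<in> carrier Q'" for x y
      by (rule X.tsum_cong[OF G X])
        (use that balanced_closed[OF h'] in \<open>simp_all add: Y.tsum_tens[OF G h']\<close>)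
  qed
qed

locale tensor_bimodule = P: bimodule K L S P + Q: bimodule K S R Q
  for K :: "'k ring" and L :: "('k, 'l) module" and S :: "('k, 's) module" and R :: "('k, 'r) module"
    and P :: "('k, 'l, 's, 'p, 'd) bimodule_scheme" and Q :: "('k, 's, 'r, 'q, 'e) bimodule_scheme"
begin

sublocale tensor_pair K S P Q ..

lemma lact_balanced:
  assumes "a \<in> carrier L"
  shows "balanced K S P Q T (\<lambda>p q. t (lact P a p) q)"
  by (rule balancedI)
    (use assms in \<open>simp_all add: P.lact_closed P.lact_add_r tens_add_l tens_add_r tens_act P.lact_ract[symmetric]
      P.lact_smult_r tens_smult\<close>)

lemma lact_tens [simp]:
  "a \<in> carrier L \<Longrightarrow> p \<in> carrier P \<Longrightarrow> q \<in> carrier Q \<Longrightarrow> lact T a (t p q) = t (lact P a p) q"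
  unfolding lact_tensor by (rule tsum_tens[OF T.abelian_group_axioms lact_balanced])

lemma lact_additive: "a \<in> carrier L \<Longrightarrow> additive_map T T (lact T a)"
  unfolding lact_tensor[abs_def] by (rule tsum_additive[OF T.abelian_group_axioms lact_balanced])

lemma ract_balanced:
  assumes "b \<in> carrier R"
  shows "balanced K S P Q T (\<lambda>p q. t p (ract Q q b))"
  by (rule balancedI)
    (use assms in \<open>simp_all add: Q.ract_closed Q.ract_add_l tens_add_l tens_add_r tens_act Q.lact_ract
      Q.ract_smult_l tens_smult\<close>)

lemma ract_tens [simp]:
  "b \<in> carrier R \<Longrightarrow> p \<in> carrier P \<Longrightarrow> q \<in> carrier Q \<Longrightarrow> ract T (t p q) b = t p (ract Q q b)"
  unfolding ract_tensor by (rule tsum_tens[OF T.abelian_group_axioms ract_balanced])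

lemma ract_additive: "b \<in> carrier R \<Longrightarrow> additive_map T T (\<lambda>X. ract T X b)"
  unfolding ract_tensor by (rule tsum_additive[OF T.abelian_group_axioms ract_balanced])

lemmas lact_closed = additive_map_closed[OF lact_additive]
lemmas lact_add = additive_map_add[OF lact_additive]
lemmas ract_closed = additive_map_closed[OF ract_additive]
lemmas ract_add = additive_map_add[OF ract_additive]

sublocale T: bimodule K L R T
proof unfold_locales
  fix a b x assume a: "a \<in> carrier L" and b: "b \<in> carrier L" and x: "x \<in> carrier T"
  show "lact T (a \<oplus>\<^bsub>L\<^esub> b) x = lact T a x \<oplus>\<^bsub>T\<^esub> lact T b x"
    using x by (induction rule: tensor_induct)
      (use a b in \<open>simp_all add: P.lact_add_l P.lact_closed tens_add_l lact_add lact_closed T.a_ac\<close>)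
  show "lact T (a \<otimes>\<^bsub>L\<^esub> b) x = lact T a (lact T b x)"
    using x by (induction rule: tensor_induct)
      (use a b in \<open>simp_all add: P.lact_assoc P.lact_closed lact_add lact_closed P.L.alg_closed\<close>)
next
  fix k a x assume k: "k \<in> carrier K" and a: "a \<in> carrier L" and x: "x \<in> carrier T"
  show "lact T (k \<odot>\<^bsub>L\<^esub> a) x = k \<odot>\<^bsub>T\<^esub> lact T a x"
    using x by (induction rule: tensor_induct)
      (use k a in \<open>simp_all add: P.lact_smult_l P.lact_closed lact_add lact_closed smult_add\<close>)
  show "lact T a (k \<odot>\<^bsub>T\<^esub> x) = k \<odot>\<^bsub>T\<^esub> lact T a x"
    using x by (induction rule: tensor_induct)
      (use k a in \<open>simp_all add: P.lact_smult_r P.lact_closed lact_add lact_closed smult_add smult_closed\<close>)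
next
  fix a b x assume x: "x \<in> carrier T" and a: "a \<in> carrier R" and b: "b \<in> carrier R"
  show "ract T x (a \<oplus>\<^bsub>R\<^esub> b) = ract T x a \<oplus>\<^bsub>T\<^esub> ract T x b"
    using x by (induction rule: tensor_induct)
      (use a b in \<open>simp_all add: Q.ract_add_r Q.ract_closed tens_add_r ract_add ract_closed T.a_ac\<close>)
  show "ract T x (a \<otimes>\<^bsub>R\<^esub> b) = ract T (ract T x a) b"
    using x by (induction rule: tensor_induct)
      (use a b in \<open>simp_all add: Q.ract_assoc Q.ract_closed ract_add ract_closed Q.S.alg_closed\<close>)
next
  fix k a x assume k: "k \<in> carrier K" and a: "a \<in> carrier R" and x: "x \<in> carrier T"
  show "ract T x (k \<odot>\<^bsub>R\<^esub> a) = k \<odot>\<^bsub>T\<^esub> ract T x a"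
    using x by (induction rule: tensor_induct)
      (use k a in \<open>simp_all add: Q.ract_smult_r Q.ract_closed ract_add ract_closed smult_add tens_smult\<close>)
  show "ract T (k \<odot>\<^bsub>T\<^esub> x) a = k \<odot>\<^bsub>T\<^esub> ract T x a"
    using x by (induction rule: tensor_induct)
      (use k a in \<open>simp_all add: Q.ract_closed ract_add ract_closed smult_add smult_closed\<close>)
next
  fix a x b assume a: "a \<in> carrier L" and x: "x \<in> carrier T" and b: "b \<in> carrier R"
  show "ract T (lact T a x) b = lact T a (ract T x b)"
    using x by (induction rule: tensor_induct)
      (use a b in \<open>simp_all add: P.lact_closed Q.ract_closed lact_add lact_closed ract_add ract_closed\<close>)
qed (simp_all add: lact_closed ract_closed lact_add ract_add)

end

section \<open>Functoriality and associativity of the tensor product\<close>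

lemma tensor_map_balanced:
  assumes "tensor_pair K S P Q" "tensor_pair K S P' Q'"
    and f: "linear_map K P P' f" "right_linear S P P' f"
    and g: "linear_map K Q Q' g" "left_linear S Q Q' g"
  shows "balanced K S P Q (tensor K S P' Q') (\<lambda>p q. tens K S P' Q' (f p) (g q))"
proof -
  interpret tensor_pair K S P Q by fact
  interpret T': tensor_pair K S P' Q' by fact
  have "f p \<in> carrier P'" if "p \<in> carrier P" for p using f(1) that by (auto simp: linear_map_def)
  moreover have "g q \<in> carrier Q'" if "q \<in> carrier Q" for q using g(1) that by (auto simp: linear_map_def)
  ultimately show ?thesis
    using f g by (intro balancedI)
      (simp_all add: linear_map_def left_linear_def right_linear_def T'.tens_add_l T'.tens_add_r
        T'.tens_act T'.tens_smult)
qed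

lemma linear_map_ident: "linear_map K M M (\<lambda>x. x)"
  by (simp add: linear_map_def)

lemma left_linear_ident: "left_linear B M M (\<lambda>x. x)"
  by (simp add: left_linear_def)

lemma right_linear_ident: "right_linear B M M (\<lambda>x. x)"
  by (simp add: right_linear_def)

text \<open>\<open>W\<close> brackets the three factors to the right and \<open>PQV\<close> to the
  left. The coassociativity laws are compared in \<open>W.T\<close>, hence the associativity map
  leads there from \<open>PQV.T\<close>.\<close>

locale tensor_triple = PQ: tensor_bimodule K L S S' P Q + QV: tensor_bimodule K S S' R Q V
  for K :: "'k ring" and L :: "('k, 'l) module" and S :: "('k, 's) module"
    and S' :: "('k, 's2) module" and R :: "('k, 'r) module"
    and P :: "('k, 'l, 's, 'p, 'd) bimodule_scheme" and Q :: "('k, 's, 's2, 'q, 'e) bimodule_scheme"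
    and V :: "('k, 's2, 'r, 'v, 'f) bimodule_scheme"
begin

sublocale W: tensor_bimodule K L S R P QV.T ..
sublocale PQV: tensor_bimodule K L S' R PQ.T V ..

lemma inner_balanced: "v \<in> carrier V \<Longrightarrow> balanced K S P Q W.T (\<lambda>p q. W.t p (QV.t q v))"
  by (rule balancedI)
    (simp_all add: W.tens_add_l QV.tens_add_l W.tens_add_r W.tens_act W.tens_smult)

text \<open>The associativity map is a nested sum whose inner sum runs over the variable
  \<open>X\<close> itself. The relations tying \<open>X\<close> to \<open>v\<close> are therefore
  checked by induction on \<open>X\<close>, while additivity in \<open>v\<close> is the parameter
  argument for fixed \<open>X\<close>.\<close>

lemma assoc_balanced:
  "balanced K S' PQ.T V W.T (\<lambda>X v. tsum W.T (\<lambda>p q. W.t p (QV.t q v)) X)"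
proof -
  let ?f = "\<lambda>X v. tsum W.T (\<lambda>p q. W.t p (QV.t q v)) X"
  note W = W.T.abelian_group_axioms
  have tens: "?f (PQ.t p q) v = W.t p (QV.t q v)"
    if "p \<in> carrier P" "q \<in> carrier Q" "v \<in> carrier V" for p q v
    using PQ.tsum_tens[OF W inner_balanced] that by simp
  have add: "additive_map PQ.T W.T (\<lambda>X. ?f X v)" if "v \<in> carrier V" for v
    by (rule PQ.tsum_additive[OF W inner_balanced[OF that]])
  show ?thesis
    unfolding balanced_def
  proof (intro conjI ballI)
    show "additive_map V W.T (?f X)" if "X \<in> carrier PQ.T" for X
      by (rule PQ.additive_tsum_param[OF W _ inner_balanced that])
        (simp_all add: additive_mapI QV.tens_add_r W.tens_add_r)
    fix X s v assume X: "X \<in> carrier PQ.T" and v: "v \<in> carrier V"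
    show "?f (ract PQ.T X s) v = ?f X (lact V s v)" if s: "s \<in> carrier S'"
      using X by (induction rule: PQ.tensor_induct)
        (simp_all add: tens s v PQ.Q.ract_closed QV.Q.lact_closed QV.tens_act PQ.ract_add
          PQ.ract_closed additive_map_add[OF add])
  next
    fix X k v assume X: "X \<in> carrier PQ.T" and k: "k \<in> carrier K" and v: "v \<in> carrier V"
    show "?f (k \<odot>\<^bsub>PQ.T\<^esub> X) v = ?f X (k \<odot>\<^bsub>V\<^esub> v)"
      using X by (induction rule: PQ.tensor_induct)
        (simp_all add: tens k v PQ.smult_add PQ.smult_closed additive_map_add[OF add]
          W.tens_smult QV.smult_tens QV.tens_smult)
  qed (rule add)
qed

lemma assoc_additive: "additive_map PQV.T W.T (tensor_assoc K S S' P Q V)"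
  using PQV.tsum_additive[OF W.T.abelian_group_axioms assoc_balanced]
  by (simp add: tensor_assoc_def[abs_def] Let_def)

lemma assoc_tens:
  "X \<in> carrier PQ.T \<Longrightarrow> v \<in> carrier V \<Longrightarrow>
    tensor_assoc K S S' P Q V (PQV.t X v) = tsum W.T (\<lambda>p q. W.t p (QV.t q v)) X"
  using PQV.tsum_tens[OF W.T.abelian_group_axioms assoc_balanced]
  by (simp add: tensor_assoc_def Let_def)

lemma assoc_tens_tens [simp]:
  "p \<in> carrier P \<Longrightarrow> q \<in> carrier Q \<Longrightarrow> v \<in> carrier V \<Longrightarrow>
    tensor_assoc K S S' P Q V (PQV.t (PQ.t p q) v) = W.t p (QV.t q v)"
  using PQ.tsum_tens[OF W.T.abelian_group_axioms inner_balanced]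
  by (simp add: assoc_tens)

end

section \<open>Dual, regular and extended bimodules\<close>

lemma regular_simps [simp]:
  "carrier (regular A) = carrier A" "ring.add (regular A) = ring.add A"
  "\<zero>\<^bsub>regular A\<^esub> = \<zero>\<^bsub>A\<^esub>" "smult (regular A) = smult A"
  "lact (regular A) = monoid.mult A" "ract (regular A) = monoid.mult A"
  by (simp_all add: regular_def module.defs bimodule.defs)

lemma bimodule_regular:
  assumes "nonunital_algebra K A"
  shows "bimodule K A A (regular A)"
proof -
  interpret A: nonunital_algebra K A by fact
  have "abelian_group (regular A)"
    by (rule abelian_groupI) (simp_all add: A.a_ac A.add.l_inv_ex)
  then have "module K (regular A)"
    by (intro moduleI) (simp_all add: A.cring_axioms A.smult_l_distr A.smult_r_distr A.smult_assoc1)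
  then interpret M: module K "regular A" .
  show ?thesis
    by unfold_locales
      (simp_all add: A.alg_closed A.alg_distr_l A.alg_distr_r A.alg_assoc A.alg_smult_l A.alg_smult_r)
qed

lemma bimodule_extend_simps [simp]:
  "carrier (bimodule.extend M m) = carrier M" "ring.add (bimodule.extend M m) = ring.add M"
  "\<zero>\<^bsub>bimodule.extend M m\<^esub> = \<zero>\<^bsub>M\<^esub>" "smult (bimodule.extend M m) = smult M"
  "lact (bimodule.extend M m) = lact M" "ract (bimodule.extend M m) = ract M"
  by (simp_all add: bimodule.defs)

text \<open>A coring record extends the record of its bimodule, so the bimodule laws have to be
  carried from one record type to the other.\<close>

lemma unital_bimodule_extend:
  assumes "unital_bimodule K A M"
  shows "unital_bimodule K A (bimodule.extend M m)"
proof -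
  interpret M: unital_bimodule K A M by fact
  let ?M = "bimodule.extend M m"
  have "abelian_group ?M"
    by (rule abelian_groupI) (simp_all add: M.M.a_ac M.M.add.l_inv_ex)
  then have "module K ?M"
    by (intro moduleI) (simp_all add: M.L.cring_axioms M.M.smult_l_distr M.M.smult_r_distr M.M.smult_assoc1)
  then interpret E: module K ?M .
  show ?thesis
    by unfold_locales
      (simp_all add: M.lact_closed M.lact_add_l M.lact_add_r M.lact_assoc M.lact_smult_l M.lact_smult_r
        M.ract_closed M.ract_add_l M.ract_add_r M.ract_assoc M.ract_smult_l M.ract_smult_r M.lact_ract
        M.ract_one M.lact_one)
qed

text \<open>A tensor product reads only the bimodule fields of its factors, so a coring structure on
  a factor is invisible to it.\<close>

lemma tensor_extend [simp]:
  "tensor K S (bimodule.extend P x) Q' = tensor K S P Q'"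
  "tensor K S P' (bimodule.extend Q y) = tensor K S P' Q"
  "tens K S (bimodule.extend P x) Q' = tens K S P Q'"
  "tens K S P' (bimodule.extend Q y) = tens K S P' Q"
  by (simp_all add: fun_eq_iff tensor_def tensor_group_def tens_def tensor_null_def tensor_relations_def
      tsum_def)

lemma tsum_extend [simp]: "tsum (bimodule.extend M m) = tsum M"
  by (rule tsum_group_cong) simp_all

section \<open>The dual of \<Sigma> as an \<open>A\<close>-\<open>R\<close>-bimodule\<close>

locale bimodule_dual = bimodule K R A \<Sigma> + unital_right_module K A \<Sigma>
  for K :: "'k ring" and R :: "('k, 'r) module" and A :: "('k, 'a) module"
    and \<Sigma> :: "('k, 'r, 'a, 's) bimodule"
begin

abbreviation "E \<equiv> dual A \<Sigma>"

lemma dual_iff: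
  "\<phi> \<in> carrier E \<longleftrightarrow> \<phi> \<in> carrier \<Sigma> \<rightarrow>\<^sub>E carrier A \<and>
     (\<forall>u \<in> carrier \<Sigma>. \<forall>v \<in> carrier \<Sigma>. \<phi> (u \<oplus>\<^bsub>\<Sigma>\<^esub> v) = \<phi> u \<oplus>\<^bsub>A\<^esub> \<phi> v) \<and>
     (\<forall>u \<in> carrier \<Sigma>. \<forall>a \<in> carrier A. \<phi> (ract \<Sigma> u a) = \<phi> u \<otimes>\<^bsub>A\<^esub> a)"
  by (simp add: dual_def right_linear_def)

lemma dual_apply [simp]:
  "u \<in> carrier \<Sigma> \<Longrightarrow> (\<phi> \<oplus>\<^bsub>E\<^esub> \<psi>) u = \<phi> u \<oplus>\<^bsub>A\<^esub> \<psi> u"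
  "u \<in> carrier \<Sigma> \<Longrightarrow> (k \<odot>\<^bsub>E\<^esub> \<phi>) u = k \<odot>\<^bsub>A\<^esub> \<phi> u"
  "u \<in> carrier \<Sigma> \<Longrightarrow> lact E a \<phi> u = a \<otimes>\<^bsub>A\<^esub> \<phi> u"
  "u \<in> carrier \<Sigma> \<Longrightarrow> ract E \<phi> r u = \<phi> (lact \<Sigma> r u)"
  "u \<in> carrier \<Sigma> \<Longrightarrow> \<zero>\<^bsub>E\<^esub> u = \<zero>\<^bsub>A\<^esub>"
  by (simp_all add: dual_def)

lemma dual_closed [simp]: "\<phi> \<in> carrier E \<Longrightarrow> u \<in> carrier \<Sigma> \<Longrightarrow> \<phi> u \<in> carrier A"
  by (auto simp: dual_iff)

lemma dual_add: "\<phi> \<in> carrier E \<Longrightarrow> u \<in> carrier \<Sigma> \<Longrightarrow> v \<in> carrier \<Sigma> \<Longrightarrow> \<phi> (u \<oplus>\<^bsub>\<Sigma>\<^esub> v) = \<phi> u \<oplus>\<^bsub>A\<^esub> \<phi> v"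
  by (simp add: dual_iff)

lemma dual_ract: "\<phi> \<in> carrier E \<Longrightarrow> u \<in> carrier \<Sigma> \<Longrightarrow> a \<in> carrier A \<Longrightarrow> \<phi> (ract \<Sigma> u a) = \<phi> u \<otimes>\<^bsub>A\<^esub> a"
  by (simp add: dual_iff)

text \<open>Right \<open>A\<close>-linear maps are \<open>K\<close>-linear because \<open>ku = u(k1)\<close>.\<close>

lemma dual_smult:
  assumes "\<phi> \<in> carrier E" "u \<in> carrier \<Sigma>" "k \<in> carrier K"
  shows "\<phi> (k \<odot>\<^bsub>\<Sigma>\<^esub> u) = k \<odot>\<^bsub>A\<^esub> \<phi> u"
proof -
  have k1: "k \<odot>\<^bsub>A\<^esub> \<one>\<^bsub>A\<^esub> \<in> carrier A" using assms by simp
  have "k \<odot>\<^bsub>\<Sigma>\<^esub> u = ract \<Sigma> u (k \<odot>\<^bsub>A\<^esub> \<one>\<^bsub>A\<^esub>)"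
    using assms by (simp add: ract_smult_r ract_one)
  then show ?thesis
    using assms k1 by (simp add: dual_ract S.alg_smult_r)
qed

lemma dual_additive: "\<phi> \<in> carrier E \<Longrightarrow> additive_map \<Sigma> A \<phi>"
  by (simp add: additive_mapI dual_add)

lemma dual_eval_additive: "u \<in> carrier \<Sigma> \<Longrightarrow> additive_map E A (\<lambda>\<phi>. \<phi> u)"
  by (simp add: additive_mapI)

lemma dual_eqI:
  assumes "\<phi> \<in> carrier E" "\<psi> \<in> carrier E" "\<And>u. u \<in> carrier \<Sigma> \<Longrightarrow> \<phi> u = \<psi> u"
  shows "\<phi> = \<psi>"
  using assms by (intro extensionalityI[of _ "carrier \<Sigma>"]) (auto simp: dual_iff PiE_iff)

lemma dual_ext: "(\<phi> \<oplus>\<^bsub>E\<^esub> \<psi>) \<in> extensional (carrier \<Sigma>)" "(k \<odot>\<^bsub>E\<^esub> \<phi>) \<in> extensional (carrier \<Sigma>)"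
  "lact E a \<phi> \<in> extensional (carrier \<Sigma>)" "ract E \<phi> r \<in> extensional (carrier \<Sigma>)"
  "\<zero>\<^bsub>E\<^esub> \<in> extensional (carrier \<Sigma>)"
  by (simp_all add: dual_def)

lemma dual_memI:
  assumes "\<phi> \<in> extensional (carrier \<Sigma>)" "\<And>u. u \<in> carrier \<Sigma> \<Longrightarrow> \<phi> u \<in> carrier A"
    and "\<And>u v. u \<in> carrier \<Sigma> \<Longrightarrow> v \<in> carrier \<Sigma> \<Longrightarrow> \<phi> (u \<oplus>\<^bsub>\<Sigma>\<^esub> v) = \<phi> u \<oplus>\<^bsub>A\<^esub> \<phi> v"
    and "\<And>u a. u \<in> carrier \<Sigma> \<Longrightarrow> a \<in> carrier A \<Longrightarrow> \<phi> (ract \<Sigma> u a) = \<phi> u \<otimes>\<^bsub>A\<^esub> a"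
  shows "\<phi> \<in> carrier E"
  using assms by (simp add: dual_iff PiE_iff)

lemma dual_zero_closed: "\<zero>\<^bsub>E\<^esub> \<in> carrier E"
proof (rule dual_memI[OF dual_ext(5)])
  \<comment> \<open>The algebra locale is not built on a ring locale, so annihilation by zero is
    rederived by cancelling in 0 a = 0 a + 0 a.\<close>
  have "\<zero>\<^bsub>A\<^esub> \<otimes>\<^bsub>A\<^esub> a = \<zero>\<^bsub>A\<^esub>" if "a \<in> carrier A" for a
    using that S.alg_distr_l[of "\<zero>\<^bsub>A\<^esub>" "\<zero>\<^bsub>A\<^esub>" a] S.alg_closed[of "\<zero>\<^bsub>A\<^esub>" a]
    by (simp add: S.add.l_cancel_one')
  then show "\<zero>\<^bsub>E\<^esub> (ract \<Sigma> u a) = \<zero>\<^bsub>E\<^esub> u \<otimes>\<^bsub>A\<^esub> a" if "u \<in> carrier \<Sigma>" "a \<in> carrier A" for u a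
    using that by (simp add: ract_closed)
qed (simp_all)

lemma dual_add_closed: "\<phi> \<in> carrier E \<Longrightarrow> \<psi> \<in> carrier E \<Longrightarrow> \<phi> \<oplus>\<^bsub>E\<^esub> \<psi> \<in> carrier E"
  by (rule dual_memI[OF dual_ext(1)])
    (simp_all add: dual_add dual_ract ract_closed S.alg_distr_l S.a_ac)

lemma dual_smult_closed: "k \<in> carrier K \<Longrightarrow> \<phi> \<in> carrier E \<Longrightarrow> k \<odot>\<^bsub>E\<^esub> \<phi> \<in> carrier E"
  by (rule dual_memI[OF dual_ext(2)])
    (simp_all add: dual_add dual_ract ract_closed S.alg_smult_l S.smult_r_distr)

lemma dual_lact_closed: "a \<in> carrier A \<Longrightarrow> \<phi> \<in> carrier E \<Longrightarrow> lact E a \<phi> \<in> carrier E"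
  by (rule dual_memI[OF dual_ext(3)])
    (simp_all add: dual_add dual_ract ract_closed S.alg_closed S.alg_distr_r S.alg_assoc)

lemma dual_ract_closed: "r \<in> carrier R \<Longrightarrow> \<phi> \<in> carrier E \<Longrightarrow> ract E \<phi> r \<in> carrier E"
  by (rule dual_memI[OF dual_ext(4)])
    (simp_all add: dual_add dual_ract ract_closed lact_closed lact_add_r lact_ract[symmetric])

lemmas dual_op_closed = dual_add_closed dual_smult_closed dual_lact_closed dual_ract_closed

lemma abelian_group_dual: "abelian_group E"
proof (rule abelian_groupI)
  fix \<phi> assume \<phi>: "\<phi> \<in> carrier E"
  \<comment> \<open>The scalar -1 provides the additive inverse, since scalar multiples are already
    known to lie in the dual.\<close>
  have "((\<ominus>\<^bsub>K\<^esub> \<one>\<^bsub>K\<^esub>) \<odot>\<^bsub>E\<^esub> \<phi>) \<oplus>\<^bsub>E\<^esub> \<phi> = \<zero>\<^bsub>E\<^esub>"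
    using \<phi> by (intro dual_eqI) (simp_all add: dual_op_closed dual_zero_closed S.smult_l_minus S.l_neg)
  then show "\<exists>\<psi> \<in> carrier E. \<psi> \<oplus>\<^bsub>E\<^esub> \<phi> = \<zero>\<^bsub>E\<^esub>"
    using \<phi> by (intro bexI[of _ "(\<ominus>\<^bsub>K\<^esub> \<one>\<^bsub>K\<^esub>) \<odot>\<^bsub>E\<^esub> \<phi>"]) (simp_all add: dual_smult_closed)
next
  fix \<phi> \<psi> \<theta> assume c: "\<phi> \<in> carrier E" "\<psi> \<in> carrier E" "\<theta> \<in> carrier E"
  show "(\<phi> \<oplus>\<^bsub>E\<^esub> \<psi>) \<oplus>\<^bsub>E\<^esub> \<theta> = \<phi> \<oplus>\<^bsub>E\<^esub> (\<psi> \<oplus>\<^bsub>E\<^esub> \<theta>)"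
    using c by (intro dual_eqI) (simp_all add: dual_op_closed S.a_ac)
next
  fix \<phi> \<psi> assume c: "\<phi> \<in> carrier E" "\<psi> \<in> carrier E"
  show "\<phi> \<oplus>\<^bsub>E\<^esub> \<psi> = \<psi> \<oplus>\<^bsub>E\<^esub> \<phi>"
    using c by (intro dual_eqI) (simp_all add: dual_op_closed S.a_ac)
next
  fix \<phi> assume c: "\<phi> \<in> carrier E"
  show "\<zero>\<^bsub>E\<^esub> \<oplus>\<^bsub>E\<^esub> \<phi> = \<phi>"
    using c by (intro dual_eqI) (simp_all add: dual_op_closed dual_zero_closed)
qed (simp_all add: dual_op_closed dual_zero_closed)

lemma module_dual: "module K E"
  by (rule moduleI, rule L.cring_axioms, rule abelian_group_dual, simp add: dual_smult_closed)
    (rule dual_eqI, simp_all add: dual_op_closed S.smult_l_distr S.smult_r_distr S.smult_assoc1)+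

sublocale E: bimodule K A R E
proof -
  interpret E: module K E by (rule module_dual)
  show "bimodule K A R E"
    by unfold_locales
      ((rule dual_eqI)?, simp_all add: dual_op_closed dual_add dual_smult lact_closed lact_add_l lact_add_r
        lact_assoc lact_smult_l lact_smult_r S.alg_closed S.alg_assoc S.alg_distr_l S.alg_distr_r
        S.alg_smult_l S.alg_smult_r L.alg_closed)+
qed

end

section \<open>The comatrix coring\<close>

locale comatrix = bimodule_dual K R A \<Sigma>
  for K :: "'k ring" and R :: "('k, 'r) module" and A :: "('k, 'a) module"
    and \<Sigma> :: "('k, 'r, 'a, 's) bimodule" +
  fixes \<iota> :: "'r \<Rightarrow> ('s, 's \<Rightarrow> 'a) tensor_elem"
  assumes firm_R: "firm_ring K R"
    and firm_Sigma: "firm_module K R \<Sigma>"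
    and iota_hom: "algebra_hom K R (dual_tensor_algebra K A \<Sigma>) \<iota>"
    and iota_action: "\<And>r u. r \<in> carrier R \<Longrightarrow> u \<in> carrier \<Sigma> \<Longrightarrow>
      lact \<Sigma> r u = induced_action \<Sigma> \<iota> r u"
begin

sublocale SE: tensor_bimodule K R A R \<Sigma> E ..
sublocale D: tensor_bimodule K A R A E \<Sigma> ..
sublocale reg: bimodule K R R "regular R"
  by (rule bimodule_regular) (rule L.nonunital_algebra_axioms)
sublocale RS: tensor_bimodule K R R A "regular R" \<Sigma> ..
sublocale RR: tensor_bimodule K R R R "regular R" "regular R" ..

sublocale D: unital_bimodule K A D.T
proof unfold_locales
  fix x assume x: "x \<in> carrier D.T"
  show "ract D.T x \<one>\<^bsub>A\<^esub> = x"
    using x by (induction rule: D.tensor_induct) (simp_all add: ract_one D.ract_add)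
  have one: "lact E \<one>\<^bsub>A\<^esub> \<phi> = \<phi>" if "\<phi> \<in> carrier E" for \<phi>
    using that by (intro dual_eqI) (simp_all add: dual_lact_closed)
  show "lact D.T \<one>\<^bsub>A\<^esub> x = x"
    using x by (induction rule: D.tensor_induct) (simp_all add: one D.lact_add)
qed

sublocale DD: tensor_bimodule K A A A D.T D.T ..
sublocale D3: tensor_triple K A A A A D.T D.T D.T ..

section \<open>The actions of \<open>R\<close> expressed through \<iota>\<close>

lemma iota_closed [simp]: "r \<in> carrier R \<Longrightarrow> \<iota> r \<in> carrier SE.T"
  and iota_add: "r \<in> carrier R \<Longrightarrow> s \<in> carrier R \<Longrightarrow> \<iota> (r \<oplus>\<^bsub>R\<^esub> s) = \<iota> r \<oplus>\<^bsub>SE.T\<^esub> \<iota> s"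
  and iota_smult: "k \<in> carrier K \<Longrightarrow> r \<in> carrier R \<Longrightarrow> \<iota> (k \<odot>\<^bsub>R\<^esub> r) = k \<odot>\<^bsub>SE.T\<^esub> \<iota> r"
  and iota_mult: "r \<in> carrier R \<Longrightarrow> s \<in> carrier R \<Longrightarrow> \<iota> (r \<otimes>\<^bsub>R\<^esub> s) =
    tsum SE.T (\<lambda>x \<phi>. tsum SE.T (\<lambda>y \<psi>. SE.t (ract \<Sigma> x (\<phi> y)) \<psi>) (\<iota> s)) (\<iota> r)"
  using iota_hom by (auto simp: algebra_hom_def linear_map_def dual_tensor_algebra_def Let_def)

lemma eval_balanced: "u \<in> carrier \<Sigma> \<Longrightarrow> balanced K A \<Sigma> E \<Sigma> (\<lambda>e \<phi>. ract \<Sigma> e (\<phi> u))"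
  by (rule balancedI)
    (simp_all add: ract_closed ract_add_l ract_add_r ract_assoc ract_smult_l ract_smult_r)

lemma lact_iota:
  "r \<in> carrier R \<Longrightarrow> u \<in> carrier \<Sigma> \<Longrightarrow> lact \<Sigma> r u = tsum \<Sigma> (\<lambda>e \<phi>. ract \<Sigma> e (\<phi> u)) (\<iota> r)"
  by (simp add: iota_action induced_action_def)

lemma pair_balanced:
  assumes "\<phi> \<in> carrier E"
  shows "balanced K A \<Sigma> E E (\<lambda>y \<psi>. lact E (\<phi> y) \<psi>)"
  by (rule balancedI)
    (use assms in \<open>simp_all add: dual_lact_closed dual_add dual_ract dual_smult E.lact_add_l E.lact_add_r
      E.lact_assoc E.lact_smult_l E.lact_smult_r\<close>)

text \<open>The action on the dual is defined by (\<phi> r)(u) = \<phi>(r u), so its description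
  through \<iota> has to be derived. At u, right linearity gives \<phi>(e_r) \<phi>_r(u) =
  \<phi>(e_r \<phi>_r(u)) = \<phi>(r u).\<close>

lemma ract_iota:
  assumes \<phi>: "\<phi> \<in> carrier E" and r: "r \<in> carrier R"
  shows "tsum E (\<lambda>e \<psi>. lact E (\<phi> e) \<psi>) (\<iota> r) = ract E \<phi> r"
proof (rule dual_eqI)
  note E = E.M.abelian_group_axioms and \<Sigma> = M.abelian_group_axioms and A = S.abelian_group_axioms
  show "tsum E (\<lambda>e \<psi>. lact E (\<phi> e) \<psi>) (\<iota> r) \<in> carrier E"
    using additive_map_closed[OF SE.tsum_additive[OF E pair_balanced[OF \<phi>]]] r by simp
  fix u assume u: "u \<in> carrier \<Sigma>"
  have "tsum E (\<lambda>e \<psi>. lact E (\<phi> e) \<psi>) (\<iota> r) u = tsum A (\<lambda>e \<psi>. lact E (\<phi> e) \<psi> u) (\<iota> r)"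
    using SE.additive_tsum[OF E A pair_balanced[OF \<phi>] dual_eval_additive[OF u]] r by simp
  also have "\<dots> = tsum A (\<lambda>e \<psi>. \<phi> (ract \<Sigma> e (\<psi> u))) (\<iota> r)"
    by (rule SE.tsum_cong[OF A iota_closed[OF r]])
      (simp_all add: u \<phi> dual_ract ract_closed)
  also have "\<dots> = \<phi> (lact \<Sigma> r u)"
    using SE.additive_tsum[OF \<Sigma> A eval_balanced[OF u] dual_additive[OF \<phi>]] r u by (simp add: lact_iota)
  finally show "tsum E (\<lambda>e \<psi>. lact E (\<phi> e) \<psi>) (\<iota> r) u = ract E \<phi> r u"
    using u by simp
qed (simp add: \<phi> r dual_ract_closed)

text \<open>In x \<phi>(y) \<otimes> \<psi> the scalar \<phi>(y) moves to the right factor, and the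
  inner sum over \<iota>(s) then collapses to \<phi> s.\<close>

lemma iota_mult_ract:
  assumes r: "r \<in> carrier R" and s: "s \<in> carrier R"
  shows "\<iota> (r \<otimes>\<^bsub>R\<^esub> s) = ract SE.T (\<iota> r) s"
proof -
  note T = SE.T.abelian_group_axioms
  have "tsum SE.T (\<lambda>y \<psi>. SE.t (ract \<Sigma> x (\<phi> y)) \<psi>) (\<iota> s) = SE.t x (ract E \<phi> s)"
    if x: "x \<in> carrier \<Sigma>" and \<phi>: "\<phi> \<in> carrier E" for x \<phi>
  proof -
    have add: "additive_map E SE.T (SE.t x)"
      using x by (simp add: additive_mapI SE.tens_add_r)
    have "tsum SE.T (\<lambda>y \<psi>. SE.t (ract \<Sigma> x (\<phi> y)) \<psi>) (\<iota> s) =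
        tsum SE.T (\<lambda>y \<psi>. SE.t x (lact E (\<phi> y) \<psi>)) (\<iota> s)"
      by (rule SE.tsum_cong[OF T iota_closed[OF s]]) (simp_all add: x \<phi> SE.tens_act dual_lact_closed)

    also have "\<dots> = SE.t x (ract E \<phi> s)"
      using SE.additive_tsum[OF E.M.abelian_group_axioms T pair_balanced[OF \<phi>] add iota_closed[OF s]]
      by (simp add: ract_iota[OF \<phi> s])
    finally show ?thesis .
  qed
  then have "\<iota> (r \<otimes>\<^bsub>R\<^esub> s) = tsum SE.T (\<lambda>x \<phi>. SE.t x (ract E \<phi> s)) (\<iota> r)"
    unfolding iota_mult[OF r s]
    by (intro SE.tsum_cong[OF T iota_closed[OF r]]) (simp_all add: s dual_ract_closed)
  then show ?thesis
    by (simp add: SE.ract_tensor)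
qed

text \<open>The same double sum, taken in the other order: summing first over \<iota>(r) collapses x
  \<phi>(y) to r y.\<close>

lemma iota_mult_lact:
  assumes r: "r \<in> carrier R" and s: "s \<in> carrier R"
  shows "\<iota> (r \<otimes>\<^bsub>R\<^esub> s) = lact SE.T r (\<iota> s)"
proof -
  note T = SE.T.abelian_group_axioms
  have bal_r: "balanced K A \<Sigma> E SE.T (\<lambda>x \<phi>. SE.t (ract \<Sigma> x (\<phi> y)) \<psi>)"
    if y: "y \<in> carrier \<Sigma>" and \<psi>: "\<psi> \<in> carrier E" for y \<psi>
    by (rule balanced_compose[OF eval_balanced[OF y] additive_mapI])
      (simp_all add: \<psi> SE.tens_add_l)
  have bal_s: "balanced K A \<Sigma> E SE.T (\<lambda>y \<psi>. SE.t (ract \<Sigma> x (\<phi> y)) \<psi>)"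
    if x: "x \<in> carrier \<Sigma>" and \<phi>: "\<phi> \<in> carrier E" for x \<phi>
    by (rule balancedI)
      (simp_all add: x \<phi> ract_closed dual_add dual_ract dual_smult ract_add_r ract_assoc ract_smult_r
        SE.tens_add_l SE.tens_add_r SE.tens_act SE.tens_smult dual_lact_closed)
  have "\<iota> (r \<otimes>\<^bsub>R\<^esub> s) =
      tsum SE.T (\<lambda>y \<psi>. tsum SE.T (\<lambda>x \<phi>. SE.t (ract \<Sigma> x (\<phi> y)) \<psi>) (\<iota> r)) (\<iota> s)"
    unfolding iota_mult[OF r s]
    by (rule tsum_swap[OF SE.tensor_pair_axioms SE.tensor_pair_axioms T bal_r bal_s
          iota_closed[OF r] iota_closed[OF s]])
  also have "\<dots> = tsum SE.T (\<lambda>y \<psi>. SE.t (lact \<Sigma> r y) \<psi>) (\<iota> s)"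
  proof (rule SE.tsum_cong[OF T iota_closed[OF s]])
    fix y \<psi> assume y: "y \<in> carrier \<Sigma>" and \<psi>: "\<psi> \<in> carrier E"
    have "additive_map \<Sigma> SE.T (\<lambda>x. SE.t x \<psi>)"
      using \<psi> by (simp add: additive_mapI SE.tens_add_l)
    from SE.additive_tsum[OF M.abelian_group_axioms T eval_balanced[OF y] this iota_closed[OF r]]
    show "tsum SE.T (\<lambda>x \<phi>. SE.t (ract \<Sigma> x (\<phi> y)) \<psi>) (\<iota> r) = SE.t (lact \<Sigma> r y) \<psi>"
      using r y by (simp add: lact_iota)
  qed (simp add: r lact_closed)
  finally show ?thesis
    by (simp add: SE.lact_tensor)
qed

section \<open>Consequences of firmness\<close>

lemma firm_balanced: "balanced K R (regular R) \<Sigma> \<Sigma> (lact \<Sigma>)"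
  by (rule balancedI)
    (simp_all add: lact_closed lact_add_l lact_add_r lact_assoc lact_smult_l lact_smult_r)

lemma firm_map_additive: "additive_map RS.T \<Sigma> (firm_map \<Sigma>)"
  unfolding firm_map_def by (rule RS.tsum_additive[OF M.abelian_group_axioms firm_balanced])

lemma firm_map_tens [simp]: "r \<in> carrier R \<Longrightarrow> u \<in> carrier \<Sigma> \<Longrightarrow> firm_map \<Sigma> (RS.t r u) = lact \<Sigma> r u"
  unfolding firm_map_def using RS.tsum_tens[OF M.abelian_group_axioms firm_balanced] by simp

lemmas firm_map_add = additive_map_add[OF firm_map_additive]
lemmas firm_map_closed = additive_map_closed[OF firm_map_additive]

lemma firm_bij: "bij_betw (firm_map \<Sigma>) (carrier RS.T) (carrier \<Sigma>)"
  using firm_Sigma by (simp add: firm_module_def)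

lemma firm_inv_eq: "X \<in> carrier RS.T \<Longrightarrow> firm_inv K R \<Sigma> (firm_map \<Sigma> X) = X"
  using firm_bij by (simp add: firm_inv_def bij_betw_def)

lemma firm_mapE:
  assumes "u \<in> carrier \<Sigma>"
  obtains X where "X \<in> carrier RS.T" "u = firm_map \<Sigma> X"
  using firm_bij assms by (auto simp: bij_betw_def)

lemma firm_inv_closed: "u \<in> carrier \<Sigma> \<Longrightarrow> firm_inv K R \<Sigma> u \<in> carrier RS.T"
  by (metis firm_inv_eq firm_mapE)

text \<open>This is injectivity of the firmness map: it makes r \<otimes> v depend only on the
  element r v, not on how that element is written.\<close>

lemma firm_inv_lact [simp]:
  "r \<in> carrier R \<Longrightarrow> u \<in> carrier \<Sigma> \<Longrightarrow> firm_inv K R \<Sigma> (lact \<Sigma> r u) = RS.t r u"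
  using firm_inv_eq[of "RS.t r u"] by simp

text \<open>Surjectivity of the firmness map, combined with induction on tensors.\<close>

lemma firm_induct [consumes 1, case_names lact add]:
  assumes "u \<in> carrier \<Sigma>"
    and "\<And>r v. r \<in> carrier R \<Longrightarrow> v \<in> carrier \<Sigma> \<Longrightarrow> Pr (lact \<Sigma> r v)"
    and "\<And>u v. u \<in> carrier \<Sigma> \<Longrightarrow> v \<in> carrier \<Sigma> \<Longrightarrow> Pr u \<Longrightarrow> Pr v \<Longrightarrow> Pr (u \<oplus>\<^bsub>\<Sigma>\<^esub> v)"
  shows "Pr u"
proof -
  obtain X where X: "X \<in> carrier RS.T" and u: "u = firm_map \<Sigma> X"
    using firm_mapE[OF assms(1)] .
  from X show ?thesis
    unfolding u by (induction rule: RS.tensor_induct) (simp_all add: assms(2,3) firm_map_add firm_map_closed)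
qed

lemma firm_inv_add:
  assumes "u \<in> carrier \<Sigma>" "v \<in> carrier \<Sigma>"
  shows "firm_inv K R \<Sigma> (u \<oplus>\<^bsub>\<Sigma>\<^esub> v) = firm_inv K R \<Sigma> u \<oplus>\<^bsub>RS.T\<^esub> firm_inv K R \<Sigma> v"
proof -
  obtain X Y where "X \<in> carrier RS.T" "u = firm_map \<Sigma> X" "Y \<in> carrier RS.T" "v = firm_map \<Sigma> Y"
    using assms by (metis firm_mapE)
  then show ?thesis
    by (metis firm_inv_eq firm_map_add RS.T.a_closed)
qed

lemma firm_inv_additive: "additive_map \<Sigma> RS.T (firm_inv K R \<Sigma>)"
  by (simp add: additive_mapI firm_inv_closed firm_inv_add)

text \<open>Surjectivity of the multiplication of \<open>R\<close> as an induction rule; it serves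
  coassociativity.\<close>

lemma ring_firm_induct [consumes 1, case_names mult add]:
  assumes "r \<in> carrier R"
    and "\<And>r s. r \<in> carrier R \<Longrightarrow> s \<in> carrier R \<Longrightarrow> Pr (r \<otimes>\<^bsub>R\<^esub> s)"
    and "\<And>r s. r \<in> carrier R \<Longrightarrow> s \<in> carrier R \<Longrightarrow> Pr r \<Longrightarrow> Pr s \<Longrightarrow> Pr (r \<oplus>\<^bsub>R\<^esub> s)"
  shows "Pr r"
proof -
  note G = reg.M.M.abelian_group_axioms
  have bal: "balanced K R (regular R) (regular R) (regular R) (lact (regular R))"
    by (rule balancedI)
      (simp_all add: L.alg_closed L.alg_distr_l L.alg_distr_r L.alg_assoc L.alg_smult_l L.alg_smult_r)
  note map = RR.tsum_additive[OF G bal]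
  have "bij_betw (firm_map (regular R)) (carrier RR.T) (carrier R)"
    using firm_R by (simp add: firm_ring_def)
  then obtain X where X: "X \<in> carrier RR.T" and r: "r = tsum (regular R) (lact (regular R)) X"
    using assms(1) by (auto simp: bij_betw_def firm_map_def)
  from X show ?thesis
    unfolding r
  proof (induction rule: RR.tensor_induct)
    case (tens p q)
    then show ?case using RR.tsum_tens[OF G bal, of p q] by (simp add: assms(2))
  next
    case (add X Y)
    then show ?case
      using additive_map_closed[OF map, of X] additive_map_closed[OF map, of Y]
        additive_map_add[OF map, of X Y]
      by (simp add: assms(3))
  qed
qed

section \<open>The formula for the comultiplication and its balancedness\<close>

text \<open>\<open>cm \<phi> v (e \<otimes> \<psi>) = (\<phi> \<otimes> e) \<otimes> (\<psi> \<otimes> v)\<close>, so that \<open>\<Delta> (\<phi> \<otimes> r v) = cm \<phi> v (\<iota> r)\<close>.\<close>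

definition cm where
  "cm \<phi> v = tsum DD.T (\<lambda>e \<psi>. DD.t (D.t \<phi> e) (D.t \<psi> v))"

lemma cm_balanced:
  assumes \<phi>: "\<phi> \<in> carrier E" and v: "v \<in> carrier \<Sigma>"
  shows "balanced K A \<Sigma> E DD.T (\<lambda>e \<psi>. DD.t (D.t \<phi> e) (D.t \<psi> v))"
proof (rule balancedI)
  fix e \<psi> assume e: "e \<in> carrier \<Sigma>" and \<psi>: "\<psi> \<in> carrier E"
  show "DD.t (D.t \<phi> (ract \<Sigma> e a)) (D.t \<psi> v) = DD.t (D.t \<phi> e) (D.t (lact E a \<psi>) v)"
    if a: "a \<in> carrier A" for a
    using DD.tens_act[of "D.t \<phi> e" a "D.t \<psi> v"] by (simp add: \<phi> v e \<psi> a)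
  show "DD.t (D.t \<phi> (k \<odot>\<^bsub>\<Sigma>\<^esub> e)) (D.t \<psi> v) = DD.t (D.t \<phi> e) (D.t (k \<odot>\<^bsub>E\<^esub> \<psi>) v)"
    if k: "k \<in> carrier K" for k
    using DD.tens_smult[of "D.t \<phi> e" k "D.t \<psi> v"] by (simp add: \<phi> v e \<psi> k D.tens_smult)
qed (simp_all add: \<phi> v D.tens_add_l D.tens_add_r DD.tens_add_l DD.tens_add_r)

lemma cm_tens [simp]:
  assumes "\<phi> \<in> carrier E" "v \<in> carrier \<Sigma>" "e \<in> carrier \<Sigma>" "\<psi> \<in> carrier E"
  shows "cm \<phi> v (SE.t e \<psi>) = DD.t (D.t \<phi> e) (D.t \<psi> v)"
  unfolding cm_def
  by (rule SE.tsum_tens[OF DD.T.abelian_group_axioms cm_balanced[OF assms(1,2)] assms(3,4)])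

lemma cm_additive: "\<phi> \<in> carrier E \<Longrightarrow> v \<in> carrier \<Sigma> \<Longrightarrow> additive_map SE.T DD.T (cm \<phi> v)"
  unfolding cm_def by (rule SE.tsum_additive[OF DD.T.abelian_group_axioms cm_balanced])

lemmas cm_add = additive_map_add[OF cm_additive]
lemmas cm_closed = additive_map_closed[OF cm_additive]

lemma cm_additive_l:
  "v \<in> carrier \<Sigma> \<Longrightarrow> Z \<in> carrier SE.T \<Longrightarrow> additive_map E DD.T (\<lambda>\<phi>. cm \<phi> v Z)"
  unfolding cm_def
  by (rule SE.additive_tsum_param[OF DD.T.abelian_group_axioms _ cm_balanced])
    (simp_all add: additive_mapI D.tens_add_l DD.tens_add_l)

lemma cm_additive_r:
  "\<phi> \<in> carrier E \<Longrightarrow> Z \<in> carrier SE.T \<Longrightarrow> additive_map \<Sigma> DD.T (\<lambda>v. cm \<phi> v Z)"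
  unfolding cm_def
  by (rule SE.additive_tsum_param[OF DD.T.abelian_group_axioms _ cm_balanced])
    (simp_all add: additive_mapI D.tens_add_r DD.tens_add_r)

text \<open>The balancing over \<open>R\<close> inside the second copy of \<Sigma>* \<otimes>
  \<Sigma> lets s pass from \<psi> to v. In \<open>cm_lact\<close> the first copy does the same
  between \<phi> and e. Together with the two forms of \<iota>(r s) these give all balancing over
  \<open>R\<close> below.\<close>

lemma cm_ract:
  assumes "Z \<in> carrier SE.T" "\<phi> \<in> carrier E" "v \<in> carrier \<Sigma>" "s \<in> carrier R"
  shows "cm \<phi> v (ract SE.T Z s) = cm \<phi> (lact \<Sigma> s v) Z"
  using assms(1) by (induction rule: SE.tensor_induct)
    (simp_all add: assms(2-) lact_closed dual_ract_closed D.tens_act cm_add SE.ract_add SE.ract_closed)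

lemma cm_lact:
  assumes "Z \<in> carrier SE.T" "\<phi> \<in> carrier E" "v \<in> carrier \<Sigma>" "s \<in> carrier R"
  shows "cm (ract E \<phi> s) v Z = cm \<phi> v (lact SE.T s Z)"
  using assms(1) by (induction rule: SE.tensor_induct)
    (simp_all add: assms(2-) lact_closed dual_ract_closed D.tens_act cm_add SE.lact_add SE.lact_closed)

text \<open>A scalar may sit on any leg or on the whole tensor; each position is normalised to the
  leg \<phi>, so that any two can be compared.\<close>

lemma cm_smult:
  assumes "Z \<in> carrier SE.T" "\<phi> \<in> carrier E" "v \<in> carrier \<Sigma>" "k \<in> carrier K"
  shows "cm \<phi> v (k \<odot>\<^bsub>SE.T\<^esub> Z) = cm (k \<odot>\<^bsub>E\<^esub> \<phi>) v Z"
    and "cm \<phi> (k \<odot>\<^bsub>\<Sigma>\<^esub> v) Z = cm (k \<odot>\<^bsub>E\<^esub> \<phi>) v Z"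
    and "k \<odot>\<^bsub>DD.T\<^esub> cm \<phi> v Z = cm (k \<odot>\<^bsub>E\<^esub> \<phi>) v Z"
proof -
  show "cm \<phi> v (k \<odot>\<^bsub>SE.T\<^esub> Z) = cm (k \<odot>\<^bsub>E\<^esub> \<phi>) v Z"
    using assms(1) by (induction rule: SE.tensor_induct)
      (simp_all add: assms(2-) dual_smult_closed D.tens_smult cm_add SE.smult_add SE.smult_closed)
  show "k \<odot>\<^bsub>DD.T\<^esub> cm \<phi> v Z = cm (k \<odot>\<^bsub>E\<^esub> \<phi>) v Z"
    using assms(1) by (induction rule: SE.tensor_induct)
      (simp_all add: assms(2-) dual_smult_closed cm_add cm_closed DD.smult_add)
  show "cm \<phi> (k \<odot>\<^bsub>\<Sigma>\<^esub> v) Z = cm (k \<odot>\<^bsub>E\<^esub> \<phi>) v Z"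
    using assms(1)
  proof (induction rule: SE.tensor_induct)
    case (tens e \<psi>)
    then show ?case
      using DD.tens_smult[of "D.t \<phi> e" k "D.t \<psi> v"] assms
      by (simp add: dual_smult_closed D.tens_smult)
  qed (simp add: assms(2-) dual_smult_closed cm_add)
qed

lemma cm_left:
  assumes "Z \<in> carrier SE.T" "\<phi> \<in> carrier E" "v \<in> carrier \<Sigma>" "a \<in> carrier A"
  shows "cm (lact E a \<phi>) v Z = lact DD.T a (cm \<phi> v Z)"
  using assms(1) by (induction rule: SE.tensor_induct)
    (simp_all add: assms(2-) dual_lact_closed cm_add cm_closed DD.lact_add)

lemma cm_right:
  assumes "Z \<in> carrier SE.T" "\<phi> \<in> carrier E" "v \<in> carrier \<Sigma>" "a \<in> carrier A"
  shows "cm \<phi> (ract \<Sigma> v a) Z = ract DD.T (cm \<phi> v Z) a"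
  using assms(1) by (induction rule: SE.tensor_induct)
    (simp_all add: assms(2-) ract_closed cm_add cm_closed DD.ract_add)

text \<open>Balancing compares (r s, v) with (r, s v): \<iota>(r s) = \<iota>(r) s, and s then
  passes to v.\<close>

lemma cm_iota_balanced:
  assumes \<phi>: "\<phi> \<in> carrier E"
  shows "balanced K R (regular R) \<Sigma> DD.T (\<lambda>r v. cm \<phi> v (\<iota> r))"
proof (rule balancedI)
  fix r s v assume "r \<in> carrier (regular R)" "s \<in> carrier R" "v \<in> carrier \<Sigma>"
  then show "cm \<phi> v (\<iota> (ract (regular R) r s)) = cm \<phi> (lact \<Sigma> s v) (\<iota> r)"
    by (simp add: \<phi> iota_mult_ract cm_ract)
qed (simp_all add: \<phi> cm_closed iota_add cm_add additive_map_add[OF cm_additive_r] iota_smult cm_smult)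

definition cmt where
  "cmt \<phi> u = tsum DD.T (\<lambda>r v. cm \<phi> v (\<iota> r)) (firm_inv K R \<Sigma> u)"

lemma cmt_lact [simp]:
  assumes "\<phi> \<in> carrier E" "r \<in> carrier R" "v \<in> carrier \<Sigma>"
  shows "cmt \<phi> (lact \<Sigma> r v) = cm \<phi> v (\<iota> r)"
  unfolding cmt_def using RS.tsum_tens[OF DD.T.abelian_group_axioms cm_iota_balanced] assms by simp

lemma cmt_additive: "\<phi> \<in> carrier E \<Longrightarrow> additive_map \<Sigma> DD.T (cmt \<phi>)"
  unfolding cmt_def[abs_def]
  by (rule additive_map_compose[OF firm_inv_additive
        RS.tsum_additive[OF DD.T.abelian_group_axioms cm_iota_balanced]])

lemmas cmt_add = additive_map_add[OF cmt_additive]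
lemmas cmt_closed = additive_map_closed[OF cmt_additive]

lemma cmt_add_l:
  assumes "u \<in> carrier \<Sigma>" "\<phi> \<in> carrier E" "\<psi> \<in> carrier E"
  shows "cmt (\<phi> \<oplus>\<^bsub>E\<^esub> \<psi>) u = cmt \<phi> u \<oplus>\<^bsub>DD.T\<^esub> cmt \<psi> u"
  using assms(1) by (induction rule: firm_induct)
    (simp_all add: assms(2,3) dual_add_closed additive_map_add[OF cm_additive_l] cmt_add cmt_closed
      DD.T.a_ac)

text \<open>On u = r v the element s u is (s r) v. Since \<iota>(s r) = s \<iota>(r), the factor s
  lands on the first leg and can be moved to \<phi>.\<close>

lemma cmt_balanced: "balanced K R E \<Sigma> DD.T cmt"
proof (rule balancedI)
  fix \<phi> s u assume \<phi>: "\<phi> \<in> carrier E" and s: "s \<in> carrier R" and u: "u \<in> carrier \<Sigma>"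
  show "cmt (ract E \<phi> s) u = cmt \<phi> (lact \<Sigma> s u)"
    using u
  proof (induction rule: firm_induct)
    case (lact r v)
    then have "cmt \<phi> (lact \<Sigma> s (lact \<Sigma> r v)) = cmt \<phi> (lact \<Sigma> (s \<otimes>\<^bsub>R\<^esub> r) v)"
      using s by (simp add: lact_assoc)
    also have "\<dots> = cm \<phi> v (lact SE.T s (\<iota> r))"
      using lact s \<phi> by (subst cmt_lact) (simp_all add: L.alg_closed iota_mult_lact)
    finally show ?case
      using lact s \<phi> by (simp add: cm_lact dual_ract_closed)
  qed (simp add: \<phi> s dual_ract_closed lact_closed lact_add_r cmt_add)
next
  fix \<phi> k u assume \<phi>: "\<phi> \<in> carrier E" and k: "k \<in> carrier K" and u: "u \<in> carrier \<Sigma>"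
  show "cmt (k \<odot>\<^bsub>E\<^esub> \<phi>) u = cmt \<phi> (k \<odot>\<^bsub>\<Sigma>\<^esub> u)"
    using u by (induction rule: firm_induct)
      (simp_all add: \<phi> k dual_smult_closed lact_closed M.smult_r_distr cmt_add lact_smult_r[symmetric] cm_smult)
qed (simp_all add: cmt_closed cmt_add cmt_add_l)

section \<open>Comultiplication and counit as bimodule maps\<close>

abbreviation "Dc \<equiv> comatrix_coring K R A \<Sigma> \<iota>"

lemma comatrix_eq:
  "Dc = bimodule.extend D.T (coring.fields (tsum DD.T cmt) (tsum A (\<lambda>\<phi> u. \<phi> u)))"
  unfolding comatrix_coring_def Let_def cmt_def[abs_def] cm_def[abs_def] ..

lemma comatrix_simps [simp]:
  "carrier Dc = carrier D.T" "ring.add Dc = ring.add D.T" "\<zero>\<^bsub>Dc\<^esub> = \<zero>\<^bsub>D.T\<^esub>" "smult Dc = smult D.T"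
  "lact Dc = lact D.T" "ract Dc = ract D.T" "tsum Dc = tsum D.T"
  "tensor K A Dc Q = tensor K A D.T Q" "tensor K A P Dc = tensor K A P D.T"
  "tens K A Dc Q = tens K A D.T Q" "tens K A P Dc = tens K A P D.T"
  by (simp_all add: comatrix_eq)

lemma comult_comatrix: "comult Dc = tsum DD.T cmt"
  and counit_comatrix: "counit Dc = tsum A (\<lambda>\<phi> u. \<phi> u)"
  by (simp_all add: comatrix_eq bimodule.defs coring.defs)

lemma comult_tens: "\<phi> \<in> carrier E \<Longrightarrow> u \<in> carrier \<Sigma> \<Longrightarrow> comult Dc (D.t \<phi> u) = cmt \<phi> u"
  unfolding comult_comatrix by (rule D.tsum_tens[OF DD.T.abelian_group_axioms cmt_balanced])

lemma comult_additive: "additive_map D.T DD.T (comult Dc)"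
  unfolding comult_comatrix by (rule D.tsum_additive[OF DD.T.abelian_group_axioms cmt_balanced])

lemmas comult_add = additive_map_add[OF comult_additive]
lemmas comult_closed = additive_map_closed[OF comult_additive]

lemma counit_balanced: "balanced K R E \<Sigma> A (\<lambda>\<phi> u. \<phi> u)"
  by (rule balancedI) (simp_all add: dual_add dual_smult)

lemma counit_tens [simp]: "\<phi> \<in> carrier E \<Longrightarrow> u \<in> carrier \<Sigma> \<Longrightarrow> counit Dc (D.t \<phi> u) = \<phi> u"
  unfolding counit_comatrix by (rule D.tsum_tens[OF S.abelian_group_axioms counit_balanced])

lemma counit_additive: "additive_map D.T A (counit Dc)"
  unfolding counit_comatrix by (rule D.tsum_additive[OF S.abelian_group_axioms counit_balanced])

lemmas counit_add = additive_map_add[OF counit_additive]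
lemmas counit_closed = additive_map_closed[OF counit_additive]

lemma comatrix_induct [consumes 1, case_names lact add]:
  assumes "X \<in> carrier D.T"
    and lact: "\<And>\<phi> r v. \<phi> \<in> carrier E \<Longrightarrow> r \<in> carrier R \<Longrightarrow> v \<in> carrier \<Sigma> \<Longrightarrow> Pr (D.t \<phi> (lact \<Sigma> r v))"
    and add: "\<And>X Y. X \<in> carrier D.T \<Longrightarrow> Y \<in> carrier D.T \<Longrightarrow> Pr X \<Longrightarrow> Pr Y \<Longrightarrow> Pr (X \<oplus>\<^bsub>D.T\<^esub> Y)"
  shows "Pr X"
  using assms(1)
proof (induction rule: D.tensor_induct)
  case (tens \<phi> u)
  from tens(2) show ?case
    by (induction rule: firm_induct) (simp_all add: tens(1) lact add D.tens_add_r)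
qed (rule add)

lemma comult_tens_lact [simp]:
  "\<phi> \<in> carrier E \<Longrightarrow> r \<in> carrier R \<Longrightarrow> v \<in> carrier \<Sigma> \<Longrightarrow>
    comult Dc (D.t \<phi> (lact \<Sigma> r v)) = cm \<phi> v (\<iota> r)"
  by (simp add: comult_tens lact_closed)

lemma comult_comatrix_linear: "linear_map K D.T DD.T (comult Dc)"
proof -
  have "comult Dc (k \<odot>\<^bsub>D.T\<^esub> X) = k \<odot>\<^bsub>DD.T\<^esub> comult Dc X"
    if X: "X \<in> carrier D.T" and k: "k \<in> carrier K" for k X
    using X by (induction rule: comatrix_induct)
      (simp_all add: k dual_smult_closed lact_closed cm_smult D.smult_add D.smult_closed comult_add
        comult_closed DD.smult_add)
  then show ?thesis
    using comult_add comult_closed by (simp add: linear_map_def)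
qed

lemma comult_comatrix_left: "left_linear A D.T DD.T (comult Dc)"
  unfolding left_linear_def
proof (intro ballI)
  fix a X assume a: "a \<in> carrier A" and X: "X \<in> carrier D.T"
  show "comult Dc (lact D.T a X) = lact DD.T a (comult Dc X)"
    using X by (induction rule: comatrix_induct)
      (simp_all add: a dual_lact_closed lact_closed cm_left D.lact_add D.lact_closed comult_add
        comult_closed DD.lact_add)
qed

lemma comult_comatrix_right: "right_linear A D.T DD.T (comult Dc)"
  unfolding right_linear_def
proof (intro ballI)
  fix a X assume a: "a \<in> carrier A" and X: "X \<in> carrier D.T"
  show "comult Dc (ract D.T X a) = ract DD.T (comult Dc X) a"
    using X by (induction rule: comatrix_induct)
      (simp_all add: a ract_closed lact_closed lact_ract cm_right D.ract_add D.ract_closed comult_add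
        comult_closed DD.ract_add)
qed

lemma counit_comatrix_linear: "linear_map K D.T A (counit Dc)"
proof -
  have "counit Dc (k \<odot>\<^bsub>D.T\<^esub> X) = k \<odot>\<^bsub>A\<^esub> counit Dc X"
    if X: "X \<in> carrier D.T" and k: "k \<in> carrier K" for k X
    using X by (induction rule: D.tensor_induct)
      (simp_all add: k dual_smult_closed D.smult_add D.smult_closed counit_add counit_closed
        S.smult_r_distr)
  then show ?thesis
    using counit_add counit_closed by (simp add: linear_map_def)
qed

lemma counit_comatrix_left: "left_linear A D.T (regular A) (counit Dc)"
  unfolding left_linear_def
proof (intro ballI)
  fix a X assume a: "a \<in> carrier A" and X: "X \<in> carrier D.T"
  show "counit Dc (lact D.T a X) = lact (regular A) a (counit Dc X)"
    using X by (induction rule: D.tensor_induct)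
      (simp_all add: a dual_lact_closed D.lact_add D.lact_closed counit_add counit_closed S.alg_distr_r)
qed

lemma counit_comatrix_right: "right_linear A D.T (regular A) (counit Dc)"
  unfolding right_linear_def
proof (intro ballI)
  fix a X assume a: "a \<in> carrier A" and X: "X \<in> carrier D.T"
  show "counit Dc (ract D.T X a) = ract (regular A) (counit Dc X) a"
    using X by (induction rule: D.tensor_induct)
      (simp_all add: a ract_closed dual_ract D.ract_add D.ract_closed counit_add counit_closed S.alg_distr_l)
qed

section \<open>Coassociativity of the comatrix coring\<close>

definition comult_l where
  "comult_l X = tensor_assoc K A A D.T D.T D.T (tensor_map K A DD.T D.T (comult Dc) (\<lambda>d. d) X)"

definition comult_r where
  "comult_r X = tensor_map K A D.T DD.T (\<lambda>d. d) (comult Dc) X"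

lemma map_l_balanced:
  "balanced K A D.T D.T D3.PQV.T (\<lambda>x y. D3.PQV.t (comult Dc x) y)"
  by (rule tensor_map_balanced[OF DD.tensor_pair_axioms D3.PQV.tensor_pair_axioms
        comult_comatrix_linear comult_comatrix_right linear_map_ident left_linear_ident])

lemma map_r_balanced:
  "balanced K A D.T D.T D3.W.T (\<lambda>x y. D3.W.t x (comult Dc y))"
  by (rule tensor_map_balanced[OF DD.tensor_pair_axioms D3.W.tensor_pair_axioms
        linear_map_ident right_linear_ident comult_comatrix_linear comult_comatrix_left])

lemma comult_l_additive: "additive_map DD.T D3.W.T comult_l"
  unfolding comult_l_def[abs_def] tensor_map_def
  by (rule additive_map_compose[OF DD.tsum_additive[OF D3.PQV.T.abelian_group_axioms map_l_balanced]
        D3.assoc_additive])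

lemma comult_r_additive: "additive_map DD.T D3.W.T comult_r"
  unfolding comult_r_def[abs_def] tensor_map_def
  by (rule DD.tsum_additive[OF D3.W.T.abelian_group_axioms map_r_balanced])

lemma comult_l_tens:
  "x \<in> carrier D.T \<Longrightarrow> y \<in> carrier D.T \<Longrightarrow>
    comult_l (DD.t x y) = tsum D3.W.T (\<lambda>p q. D3.W.t p (DD.t q y)) (comult Dc x)"
  using DD.tsum_tens[OF D3.PQV.T.abelian_group_axioms map_l_balanced, of x y]
  by (simp add: comult_l_def tensor_map_def D3.assoc_tens comult_closed)

lemma comult_r_tens:
  "x \<in> carrier D.T \<Longrightarrow> y \<in> carrier D.T \<Longrightarrow> comult_r (DD.t x y) = D3.W.t x (comult Dc y)"
  using DD.tsum_tens[OF D3.W.T.abelian_group_axioms map_r_balanced, of x y]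
  by (simp add: comult_r_def tensor_map_def)

text \<open>The common summand of the two iterated comultiplications at \<phi> \<otimes> (r s) v:
  the pair (e, \<psi>) runs over \<iota>(r) and the pair (e', \<psi>') over \<iota>(s).\<close>

definition quad where
  "quad \<phi> v e \<psi> e' \<psi>' = D3.W.t (D.t \<phi> e) (DD.t (D.t \<psi> e') (D.t \<psi>' v))"

lemma quad_balanced_l:
  assumes "\<phi> \<in> carrier E" "v \<in> carrier \<Sigma>" "e' \<in> carrier \<Sigma>" "\<psi>' \<in> carrier E"
  shows "balanced K A \<Sigma> E D3.W.T (\<lambda>e \<psi>. quad \<phi> v e \<psi> e' \<psi>')"
  unfolding quad_def
proof (rule balancedI)
  fix e \<psi> assume e: "e \<in> carrier \<Sigma>" and \<psi>: "\<psi> \<in> carrier E"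
  let ?Y = "D.t \<psi>' v"
  show "D3.W.t (D.t \<phi> (ract \<Sigma> e a)) (DD.t (D.t \<psi> e') ?Y) =
      D3.W.t (D.t \<phi> e) (DD.t (D.t (lact E a \<psi>) e') ?Y)" if a: "a \<in> carrier A" for a
    using D3.W.tens_act[of "D.t \<phi> e" a "DD.t (D.t \<psi> e') ?Y"] by (simp add: assms e \<psi> a)
  show "D3.W.t (D.t \<phi> (k \<odot>\<^bsub>\<Sigma>\<^esub> e)) (DD.t (D.t \<psi> e') ?Y) =
      D3.W.t (D.t \<phi> e) (DD.t (D.t (k \<odot>\<^bsub>E\<^esub> \<psi>) e') ?Y)" if k: "k \<in> carrier K" for k
    using D3.W.tens_smult[of "D.t \<phi> e" k "DD.t (D.t \<psi> e') ?Y"]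
    by (simp add: assms e \<psi> k D.tens_smult)
qed (simp_all add: assms D.tens_add_l D.tens_add_r DD.tens_add_l D3.W.tens_add_l D3.W.tens_add_r)

lemma quad_balanced_r:
  assumes "\<phi> \<in> carrier E" "v \<in> carrier \<Sigma>" "e \<in> carrier \<Sigma>" "\<psi> \<in> carrier E"
  shows "balanced K A \<Sigma> E D3.W.T (quad \<phi> v e \<psi>)"
  unfolding quad_def[abs_def]
  \<comment> \<open>With the outer left leg fixed, what remains is the summand of \<open>cm\<close>
    for \<psi> and v.\<close>
  by (rule balanced_compose[OF cm_balanced additive_mapI])
    (simp_all add: assms D3.W.tens_add_r)

text \<open>The factor r turns the left leg into \<phi> \<otimes> r e', exactly the form on which
  the comultiplication is explicit, and the inner sum over \<iota>(r) appears.\<close>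

lemma comult_l_cm:
  assumes \<phi>: "\<phi> \<in> carrier E" and v: "v \<in> carrier \<Sigma>" and r: "r \<in> carrier R" and Z: "Z \<in> carrier SE.T"
  shows "comult_l (cm \<phi> v (lact SE.T r Z)) =
    tsum D3.W.T (\<lambda>e' \<psi>'. tsum D3.W.T (\<lambda>e \<psi>. quad \<phi> v e \<psi> e' \<psi>') (\<iota> r)) Z"
proof (rule SE.tsum_eqI[symmetric, OF _ _ _ Z])
  note W = D3.W.T.abelian_group_axioms
  show "abelian_group D3.W.T" by (rule W)
  show "balanced K A \<Sigma> E D3.W.T (\<lambda>e' \<psi>'. tsum D3.W.T (\<lambda>e \<psi>. quad \<phi> v e \<psi> e' \<psi>') (\<iota> r))"
    by (rule tsum_param_balanced[OF SE.tensor_pair_axioms W quad_balanced_l[OF \<phi> v]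
          quad_balanced_r[OF \<phi> v] iota_closed[OF r] right_module_axioms E.left_module_axioms])
  show "additive_map SE.T D3.W.T (\<lambda>Z. comult_l (cm \<phi> v (lact SE.T r Z)))"
    by (rule additive_map_compose[OF additive_map_compose[OF SE.lact_additive[OF r] cm_additive[OF \<phi> v]]
          comult_l_additive])
  fix e' \<psi>' assume e': "e' \<in> carrier \<Sigma>" and \<psi>': "\<psi>' \<in> carrier E"
  let ?g = "tsum D3.W.T (\<lambda>p q. D3.W.t p (DD.t q (D.t \<psi>' v)))"
  have bal: "balanced K A D.T D.T D3.W.T (\<lambda>p q. D3.W.t p (DD.t q (D.t \<psi>' v)))"
    by (rule D3.inner_balanced) (simp add: v \<psi>')
  have "?g (cm \<phi> e' (\<iota> r)) = tsum D3.W.T (\<lambda>e \<psi>. quad \<phi> v e \<psi> e' \<psi>') (\<iota> r)"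
  proof (rule SE.tsum_eqI[symmetric, OF W quad_balanced_l[OF \<phi> v e' \<psi>'] _ iota_closed[OF r]])
    show "additive_map SE.T D3.W.T (\<lambda>Z. ?g (cm \<phi> e' Z))"
      by (rule additive_map_compose[OF cm_additive[OF \<phi> e'] DD.tsum_additive[OF W bal]])
    show "?g (cm \<phi> e' (SE.t e \<psi>)) = quad \<phi> v e \<psi> e' \<psi>'"
      if "e \<in> carrier \<Sigma>" "\<psi> \<in> carrier E" for e \<psi>
      using that \<phi> e' by (simp add: quad_def DD.tsum_tens[OF W bal])
  qed
  then show "comult_l (cm \<phi> v (lact SE.T r (SE.t e' \<psi>'))) =
      tsum D3.W.T (\<lambda>e \<psi>. quad \<phi> v e \<psi> e' \<psi>') (\<iota> r)"
    by (simp add: \<phi> v r e' \<psi>' lact_closed comult_l_tens)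
qed

text \<open>Mirror image of the left-hand computation: \<psi> s \<otimes> v = \<psi> \<otimes> s v
  puts the right leg into the explicit form.\<close>

lemma comult_r_cm:
  assumes \<phi>: "\<phi> \<in> carrier E" and v: "v \<in> carrier \<Sigma>" and s: "s \<in> carrier R" and Y: "Y \<in> carrier SE.T"
  shows "comult_r (cm \<phi> v (ract SE.T Y s)) =
    tsum D3.W.T (\<lambda>e \<psi>. tsum D3.W.T (quad \<phi> v e \<psi>) (\<iota> s)) Y"
proof (rule SE.tsum_eqI[symmetric, OF _ _ _ Y])
  note W = D3.W.T.abelian_group_axioms
  show "abelian_group D3.W.T" by (rule W)
  show "balanced K A \<Sigma> E D3.W.T (\<lambda>e \<psi>. tsum D3.W.T (quad \<phi> v e \<psi>) (\<iota> s))"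
    by (rule tsum_param_balanced[OF SE.tensor_pair_axioms W quad_balanced_r[OF \<phi> v]
          quad_balanced_l[OF \<phi> v] iota_closed[OF s] right_module_axioms E.left_module_axioms])
  show "additive_map SE.T D3.W.T (\<lambda>Y. comult_r (cm \<phi> v (ract SE.T Y s)))"
    by (rule additive_map_compose[OF additive_map_compose[OF SE.ract_additive[OF s] cm_additive[OF \<phi> v]]
          comult_r_additive])
  fix e \<psi> assume e: "e \<in> carrier \<Sigma>" and \<psi>: "\<psi> \<in> carrier E"
  have "D3.W.t (D.t \<phi> e) (cm \<psi> v (\<iota> s)) = tsum D3.W.T (quad \<phi> v e \<psi>) (\<iota> s)"
  proof (rule SE.tsum_eqI[symmetric, OF W quad_balanced_r[OF \<phi> v e \<psi>] _ iota_closed[OF s]])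
    show "additive_map SE.T D3.W.T (\<lambda>Z. D3.W.t (D.t \<phi> e) (cm \<psi> v Z))"
      by (rule additive_map_compose[OF cm_additive[OF \<psi> v] additive_mapI])
        (simp_all add: \<phi> e D3.W.tens_add_r)
  qed (simp add: quad_def \<psi> v)
  then show "comult_r (cm \<phi> v (ract SE.T (SE.t e \<psi>) s)) = tsum D3.W.T (quad \<phi> v e \<psi>) (\<iota> s)"
    by (simp add: \<phi> v s e \<psi> dual_ract_closed lact_closed comult_r_tens D.tens_act)
qed

text \<open>Since \<open>R\<close> is firm, it is spanned by products; for \<open>r s\<close> both sides are the same double sum over
  \<open>\<iota> r\<close> and \<open>\<iota> s\<close>, because \<open>\<iota> (r s) = r \<iota> s = (\<iota> r) s\<close>.\<close>

lemma comult_l_eq_comult_r: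
  assumes "r \<in> carrier R" and \<phi>: "\<phi> \<in> carrier E" and v: "v \<in> carrier \<Sigma>"
  shows "comult_l (cm \<phi> v (\<iota> r)) = comult_r (cm \<phi> v (\<iota> r))"
  using assms(1)
proof (induction rule: ring_firm_induct)
  case (mult r s)
  note W = D3.W.T.abelian_group_axioms
  have "comult_l (cm \<phi> v (\<iota> (r \<otimes>\<^bsub>R\<^esub> s))) =
      tsum D3.W.T (\<lambda>e' \<psi>'. tsum D3.W.T (\<lambda>e \<psi>. quad \<phi> v e \<psi> e' \<psi>') (\<iota> r)) (\<iota> s)"
    using mult \<phi> v by (simp add: iota_mult_lact comult_l_cm)
  also have "\<dots> = tsum D3.W.T (\<lambda>e \<psi>. tsum D3.W.T (quad \<phi> v e \<psi>) (\<iota> s)) (\<iota> r)"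
    by (rule tsum_swap[symmetric, OF SE.tensor_pair_axioms SE.tensor_pair_axioms W
          quad_balanced_l[OF \<phi> v] quad_balanced_r[OF \<phi> v] iota_closed[OF mult(1)] iota_closed[OF mult(2)]])
  also have "\<dots> = comult_r (cm \<phi> v (\<iota> (r \<otimes>\<^bsub>R\<^esub> s)))"
    using mult \<phi> v by (simp add: iota_mult_ract comult_r_cm)
  finally show ?case .
next
  case (add r s)
  then show ?case
    using \<phi> v by (simp add: iota_add cm_add cm_closed additive_map_add[OF comult_l_additive]
        additive_map_add[OF comult_r_additive])
qed

lemma comatrix_coassoc:
  assumes "c \<in> carrier D.T"
  shows "comult_l (comult Dc c) = comult_r (comult Dc c)"
  using assms by (induction rule: comatrix_induct)
    (simp_all add: comult_l_eq_comult_r comult_add comult_closed additive_map_add[OF comult_l_additive]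
      additive_map_add[OF comult_r_additive])

section \<open>Counit laws of the comatrix coring\<close>

lemma counit_lact: "a \<in> carrier A \<Longrightarrow> X \<in> carrier D.T \<Longrightarrow> counit Dc (lact D.T a X) = a \<otimes>\<^bsub>A\<^esub> counit Dc X"
  and counit_ract: "a \<in> carrier A \<Longrightarrow> X \<in> carrier D.T \<Longrightarrow> counit Dc (ract D.T X a) = counit Dc X \<otimes>\<^bsub>A\<^esub> a"
  and counit_smult: "k \<in> carrier K \<Longrightarrow> X \<in> carrier D.T \<Longrightarrow> counit Dc (k \<odot>\<^bsub>D.T\<^esub> X) = k \<odot>\<^bsub>A\<^esub> counit Dc X"
  using counit_comatrix_left counit_comatrix_right counit_comatrix_linear
  by (simp_all add: left_linear_def right_linear_def linear_map_def)

text \<open>Contracting the first leg leaves \<phi>(e_r) \<phi>_r \<otimes> v, which is \<phi> r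
  \<otimes> v = \<phi> \<otimes> r v by balancing.\<close>

lemma comatrix_counit_l:
  assumes "c \<in> carrier D.T"
  shows "tsum D.T (\<lambda>c1 c2. lact D.T (counit Dc c1) c2) (comult Dc c) = c"
proof -
  let ?h = "tsum D.T (\<lambda>c1 c2. lact D.T (counit Dc c1) c2)"
  note T = D.T.abelian_group_axioms
  have bal: "balanced K A D.T D.T D.T (\<lambda>c1 c2. lact D.T (counit Dc c1) c2)"
    by (rule balancedI)
      (simp_all add: counit_closed D.lact_closed counit_add D.T.lact_add_l D.lact_add counit_ract
        D.T.lact_assoc counit_smult D.T.lact_smult_l D.T.lact_smult_r)
  note add = DD.tsum_additive[OF T bal]
  have "?h (cm \<phi> v (\<iota> r)) = D.t \<phi> (lact \<Sigma> r v)"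
    if \<phi>: "\<phi> \<in> carrier E" and r: "r \<in> carrier R" and v: "v \<in> carrier \<Sigma>" for \<phi> r v
  proof -
    have "?h (cm \<phi> v (\<iota> r)) = D.t (tsum E (\<lambda>e \<psi>. lact E (\<phi> e) \<psi>) (\<iota> r)) v"
    proof (rule SE.tensor_ext[OF _ _ _ iota_closed[OF r]])
      show "additive_map SE.T D.T (\<lambda>Z. ?h (cm \<phi> v Z))"
        by (rule additive_map_compose[OF cm_additive[OF \<phi> v] add])
      show "additive_map SE.T D.T (\<lambda>Z. D.t (tsum E (\<lambda>e \<psi>. lact E (\<phi> e) \<psi>) Z) v)"
        by (rule additive_map_compose[OF SE.tsum_additive[OF E.M.abelian_group_axioms pair_balanced[OF \<phi>]]
              additive_mapI])
          (simp_all add: v D.tens_add_l)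
    qed (simp add: \<phi> v DD.tsum_tens[OF T bal] SE.tsum_tens[OF E.M.abelian_group_axioms pair_balanced[OF \<phi>]])
    then show ?thesis
      by (simp add: \<phi> r v ract_iota D.tens_act)
  qed
  with assms show ?thesis
    by (induction rule: comatrix_induct)
      (simp_all add: comult_add comult_closed additive_map_add[OF add])
qed

text \<open>Contracting the second leg leaves \<phi> \<otimes> e_r \<phi>_r(v), which is \<phi>
  \<otimes> r v by the definition of the induced action.\<close>

lemma comatrix_counit_r:
  assumes "c \<in> carrier D.T"
  shows "tsum D.T (\<lambda>c1 c2. ract D.T c1 (counit Dc c2)) (comult Dc c) = c"
proof -
  let ?h = "tsum D.T (\<lambda>c1 c2. ract D.T c1 (counit Dc c2))"
  note T = D.T.abelian_group_axioms
  have bal: "balanced K A D.T D.T D.T (\<lambda>c1 c2. ract D.T c1 (counit Dc c2))"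
    by (rule balancedI)
      (simp_all add: counit_closed D.ract_closed counit_add D.T.ract_add_r D.ract_add counit_lact
        D.T.ract_assoc counit_smult D.T.ract_smult_l D.T.ract_smult_r)
  note add = DD.tsum_additive[OF T bal]
  have "?h (cm \<phi> v (\<iota> r)) = D.t \<phi> (lact \<Sigma> r v)"
    if \<phi>: "\<phi> \<in> carrier E" and r: "r \<in> carrier R" and v: "v \<in> carrier \<Sigma>" for \<phi> r v
  proof -
    have "?h (cm \<phi> v (\<iota> r)) = D.t \<phi> (tsum \<Sigma> (\<lambda>e \<psi>. ract \<Sigma> e (\<psi> v)) (\<iota> r))"
    proof (rule SE.tensor_ext[OF _ _ _ iota_closed[OF r]])
      show "additive_map SE.T D.T (\<lambda>Z. ?h (cm \<phi> v Z))"
        by (rule additive_map_compose[OF cm_additive[OF \<phi> v] add])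
      show "additive_map SE.T D.T (\<lambda>Z. D.t \<phi> (tsum \<Sigma> (\<lambda>e \<psi>. ract \<Sigma> e (\<psi> v)) Z))"
        by (rule additive_map_compose[OF SE.tsum_additive[OF M.abelian_group_axioms eval_balanced[OF v]]
              additive_mapI])
          (simp_all add: \<phi> D.tens_add_r)
    qed (simp add: \<phi> v DD.tsum_tens[OF T bal] SE.tsum_tens[OF M.abelian_group_axioms eval_balanced[OF v]])
    then show ?thesis
      by (simp add: r v lact_iota)
  qed
  with assms show ?thesis
    by (induction rule: comatrix_induct)
      (simp_all add: comult_add comult_closed additive_map_add[OF add])
qed

lemma tensor_map_comatrix [simp]:
  "tensor_map K A Dc Q = tensor_map K A D.T Q" "tensor_map K A P Dc = tensor_map K A P D.T"
  by (simp_all add: fun_eq_iff tensor_map_def)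

lemma tensor_assoc_comatrix: "tensor_assoc K A A Dc Dc Dc = tensor_assoc K A A D.T D.T D.T"
  by (simp add: fun_eq_iff tensor_assoc_def)

theorem coring_comatrix: "coring K A Dc"
proof -
  have "unital_bimodule K A Dc"
    unfolding comatrix_eq by (rule unital_bimodule_extend[OF D.unital_bimodule_axioms])
  then interpret Dc: unital_bimodule K A Dc .
  show ?thesis
  proof unfold_locales
    show "linear_map K Dc (tensor K A Dc Dc) (comult Dc)"
      using comult_comatrix_linear by (simp add: linear_map_def)
    show "left_linear A Dc (tensor K A Dc Dc) (comult Dc)"
      using comult_comatrix_left by (simp add: left_linear_def)
    show "right_linear A Dc (tensor K A Dc Dc) (comult Dc)"
      using comult_comatrix_right by (simp add: right_linear_def)
    show "linear_map K Dc A (counit Dc)"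
      using counit_comatrix_linear by (simp add: linear_map_def)
    show "left_linear A Dc (regular A) (counit Dc)"
      using counit_comatrix_left by (simp add: left_linear_def)
    show "right_linear A Dc (regular A) (counit Dc)"
      using counit_comatrix_right by (simp add: right_linear_def)
  qed (simp_all add: comatrix_counit_l comatrix_counit_r tensor_assoc_comatrix
      comatrix_coassoc[unfolded comult_l_def comult_r_def])
qed

end

section \<open>The canonical map\<close>

locale comatrix_comodule = comatrix K R A \<Sigma> \<iota> + bicomodule K R A C \<Sigma> \<rho>
  for K :: "'k ring" and R :: "('k, 'r) module" and A :: "('k, 'a) module"
    and \<Sigma> :: "('k, 'r, 'a, 's) bimodule" and \<iota> :: "'r \<Rightarrow> ('s, 's \<Rightarrow> 'a) tensor_elem"
    and C :: "('k, 'a, 'c) coring" and \<rho> :: "'s \<Rightarrow> ('s, 'c) tensor_elem"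
begin

sublocale SC: tensor_bimodule K R A A \<Sigma> C ..
sublocale CC: tensor_bimodule K A A A C C ..
sublocale SCC: tensor_triple K R A A A \<Sigma> C C ..

lemmas C_group = C.M.abelian_group_axioms
lemmas CC_group = CC.T.abelian_group_axioms

section \<open>The coaction and its contraction with functionals\<close>

lemma rho_closed [simp]: "u \<in> carrier \<Sigma> \<Longrightarrow> \<rho> u \<in> carrier SC.T"
  and rho_add: "u \<in> carrier \<Sigma> \<Longrightarrow> v \<in> carrier \<Sigma> \<Longrightarrow> \<rho> (u \<oplus>\<^bsub>\<Sigma>\<^esub> v) = \<rho> u \<oplus>\<^bsub>SC.T\<^esub> \<rho> v"
  and rho_smult: "k \<in> carrier K \<Longrightarrow> u \<in> carrier \<Sigma> \<Longrightarrow> \<rho> (k \<odot>\<^bsub>\<Sigma>\<^esub> u) = k \<odot>\<^bsub>SC.T\<^esub> \<rho> u"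
  and rho_lact: "r \<in> carrier R \<Longrightarrow> u \<in> carrier \<Sigma> \<Longrightarrow> \<rho> (lact \<Sigma> r u) = lact SC.T r (\<rho> u)"
  and rho_ract: "u \<in> carrier \<Sigma> \<Longrightarrow> a \<in> carrier A \<Longrightarrow> \<rho> (ract \<Sigma> u a) = ract SC.T (\<rho> u) a"
  using coaction_linear coaction_left coaction_right
  by (auto simp: linear_map_def left_linear_def right_linear_def)

text \<open>\<open>cap \<phi>\<close> is \<open>\<phi> \<otimes> C : \<Sigma> \<otimes>\<^sub>A C \<rightarrow> C\<close>, so that \<open>can (\<phi> \<otimes> x) = cap \<phi> (\<rho> x)\<close>.\<close>

definition cap where
  "cap \<phi> = tsum C (\<lambda>u c. lact C (\<phi> u) c)"

lemma cap_balanced: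
  assumes "\<phi> \<in> carrier E"
  shows "balanced K A \<Sigma> C C (\<lambda>u c. lact C (\<phi> u) c)"
  by (rule balancedI)
    (use assms in \<open>simp_all add: C.lact_closed dual_add dual_ract dual_smult C.lact_add_l C.lact_add_r
      C.lact_assoc C.lact_smult_l C.lact_smult_r\<close>)

lemma cap_tens [simp]:
  "\<phi> \<in> carrier E \<Longrightarrow> u \<in> carrier \<Sigma> \<Longrightarrow> c \<in> carrier C \<Longrightarrow> cap \<phi> (SC.t u c) = lact C (\<phi> u) c"
  unfolding cap_def by (rule SC.tsum_tens[OF C_group cap_balanced])

lemma cap_additive: "\<phi> \<in> carrier E \<Longrightarrow> additive_map SC.T C (cap \<phi>)"
  unfolding cap_def by (rule SC.tsum_additive[OF C_group cap_balanced])

lemmas cap_add = additive_map_add[OF cap_additive]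
lemmas cap_closed = additive_map_closed[OF cap_additive]

lemma cap_additive_l: "Y \<in> carrier SC.T \<Longrightarrow> additive_map E C (\<lambda>\<phi>. cap \<phi> Y)"
  unfolding cap_def
  by (rule SC.additive_tsum_param[OF C_group _ cap_balanced])
    (simp_all add: additive_mapI C.lact_closed C.lact_add_l)

lemma cap_dual_ract:
  assumes "Y \<in> carrier SC.T" "\<phi> \<in> carrier E" "r \<in> carrier R"
  shows "cap (ract E \<phi> r) Y = cap \<phi> (lact SC.T r Y)"
  using assms(1) by (induction rule: SC.tensor_induct)
    (simp_all add: assms(2-) dual_ract_closed lact_closed cap_add SC.lact_add SC.lact_closed)

lemma cap_smult:
  assumes "Y \<in> carrier SC.T" "\<phi> \<in> carrier E" "k \<in> carrier K"
  shows "cap (k \<odot>\<^bsub>E\<^esub> \<phi>) Y = cap \<phi> (k \<odot>\<^bsub>SC.T\<^esub> Y)"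
    and "cap (k \<odot>\<^bsub>E\<^esub> \<phi>) Y = k \<odot>\<^bsub>C\<^esub> cap \<phi> Y"
proof -
  show "cap (k \<odot>\<^bsub>E\<^esub> \<phi>) Y = cap \<phi> (k \<odot>\<^bsub>SC.T\<^esub> Y)"
    using assms(1) by (induction rule: SC.tensor_induct)
      (simp_all add: assms(2-) dual_smult dual_smult_closed cap_add SC.smult_add SC.smult_closed)
  show "cap (k \<odot>\<^bsub>E\<^esub> \<phi>) Y = k \<odot>\<^bsub>C\<^esub> cap \<phi> Y"
    using assms(1) by (induction rule: SC.tensor_induct)
      (simp_all add: assms(2-) dual_smult_closed cap_add cap_closed C.lact_smult_l C.M.smult_r_distr)
qed

lemma cap_lact:
  assumes "Y \<in> carrier SC.T" "\<phi> \<in> carrier E" "a \<in> carrier A"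
  shows "cap (lact E a \<phi>) Y = lact C a (cap \<phi> Y)"
  using assms(1) by (induction rule: SC.tensor_induct)
    (simp_all add: assms(2-) dual_lact_closed cap_add cap_closed C.lact_assoc C.lact_add_r)

lemma cap_ract:
  assumes "Y \<in> carrier SC.T" "\<phi> \<in> carrier E" "a \<in> carrier A"
  shows "cap \<phi> (ract SC.T Y a) = ract C (cap \<phi> Y) a"
  using assms(1) by (induction rule: SC.tensor_induct)
    (simp_all add: assms(2-) C.ract_closed cap_add cap_closed C.lact_ract SC.ract_add SC.ract_closed
      C.ract_add_l)

text \<open>Balancing over \<open>R\<close> rests on left linearity of the coaction: contracting
  \<rho>(x) with \<phi> r is contracting r \<rho>(x) = \<rho>(r x) with \<phi>.\<close>

lemma can_balanced: "balanced K R E \<Sigma> C (\<lambda>\<phi> x. cap \<phi> (\<rho> x))"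
  by (rule balancedI)
    (simp_all add: cap_closed rho_add cap_add additive_map_add[OF cap_additive_l] cap_dual_ract
      rho_lact rho_smult cap_smult(1))

section \<open>The canonical map as a bimodule map\<close>

lemma can_eq: "can C \<rho> = tsum C (\<lambda>\<phi> x. cap \<phi> (\<rho> x))"
  by (simp add: can_def cap_def)

lemma can_tens: "\<phi> \<in> carrier E \<Longrightarrow> x \<in> carrier \<Sigma> \<Longrightarrow> can C \<rho> (D.t \<phi> x) = cap \<phi> (\<rho> x)"
  unfolding can_eq by (rule D.tsum_tens[OF C_group can_balanced])

lemma can_additive: "additive_map D.T C (can C \<rho>)"
  unfolding can_eq by (rule D.tsum_additive[OF C_group can_balanced])

lemmas can_add = additive_map_add[OF can_additive]
lemmas can_closed = additive_map_closed[OF can_additive]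

lemma can_smult:
  assumes "X \<in> carrier D.T" "k \<in> carrier K"
  shows "can C \<rho> (k \<odot>\<^bsub>D.T\<^esub> X) = k \<odot>\<^bsub>C\<^esub> can C \<rho> X"
  using assms(1) by (induction rule: D.tensor_induct)
    (simp_all add: assms(2) can_tens dual_smult_closed cap_smult(2) D.smult_add D.smult_closed can_add
      can_closed C.M.smult_r_distr)

lemma can_lact:
  assumes "X \<in> carrier D.T" "a \<in> carrier A"
  shows "can C \<rho> (lact D.T a X) = lact C a (can C \<rho> X)"
  using assms(1) by (induction rule: D.tensor_induct)
    (simp_all add: assms(2) can_tens dual_lact_closed cap_lact D.lact_add D.lact_closed can_add
      can_closed C.lact_add_r)

lemma can_ract:
  assumes "X \<in> carrier D.T" "a \<in> carrier A"
  shows "can C \<rho> (ract D.T X a) = ract C (can C \<rho> X) a"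
  using assms(1) by (induction rule: D.tensor_induct)
    (simp_all add: assms(2) can_tens ract_closed rho_ract cap_ract D.ract_add D.ract_closed can_add
      can_closed C.ract_add_l)

section \<open>Compatibility with the counits\<close>

lemma counit_C_closed: "c \<in> carrier C \<Longrightarrow> counit C c \<in> carrier A"
  and counit_C_add: "c \<in> carrier C \<Longrightarrow> d \<in> carrier C \<Longrightarrow> counit C (c \<oplus>\<^bsub>C\<^esub> d) = counit C c \<oplus>\<^bsub>A\<^esub> counit C d"
  and counit_C_smult: "k \<in> carrier K \<Longrightarrow> c \<in> carrier C \<Longrightarrow> counit C (k \<odot>\<^bsub>C\<^esub> c) = k \<odot>\<^bsub>A\<^esub> counit C c"
  and counit_C_lact: "a \<in> carrier A \<Longrightarrow> c \<in> carrier C \<Longrightarrow> counit C (lact C a c) = a \<otimes>\<^bsub>A\<^esub> counit C c"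
  using C.counit_linear C.counit_left by (auto simp: linear_map_def left_linear_def)

lemma comult_C_closed: "c \<in> carrier C \<Longrightarrow> comult C c \<in> carrier CC.T"
  and comult_C_add: "c \<in> carrier C \<Longrightarrow> d \<in> carrier C \<Longrightarrow> comult C (c \<oplus>\<^bsub>C\<^esub> d) = comult C c \<oplus>\<^bsub>CC.T\<^esub> comult C d"
  and comult_C_lact: "a \<in> carrier A \<Longrightarrow> c \<in> carrier C \<Longrightarrow> comult C (lact C a c) = lact CC.T a (comult C c)"
  using C.comult_linear C.comult_left by (auto simp: linear_map_def left_linear_def)

text \<open>Linearity of the counit and of \<phi> gives \<epsilon>(\<phi>(x_[0]) x_[1]) =
  \<phi>(x_[0]) \<epsilon>(x_[1]) = \<phi>(x_[0] \<epsilon>(x_[1])), and the comodule counit law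
  turns this into \<phi>(x).\<close>

lemma counit_can:
  assumes "X \<in> carrier D.T"
  shows "counit C (can C \<rho> X) = counit Dc X"
  using assms
proof (induction rule: D.tensor_induct)
  case (tens \<phi> x)
  have bal: "balanced K A \<Sigma> C \<Sigma> (\<lambda>v c. ract \<Sigma> v (counit C c))"
    by (rule balancedI)
      (simp_all add: counit_C_closed ract_closed ract_add_l counit_C_add ract_add_r counit_C_lact
        ract_assoc counit_C_smult ract_smult_l ract_smult_r)
  note G = M.abelian_group_axioms
  have "counit C (cap \<phi> (\<rho> x)) = \<phi> (tsum \<Sigma> (\<lambda>v c. ract \<Sigma> v (counit C c)) (\<rho> x))"
  proof (rule SC.tensor_ext[OF _ _ _ rho_closed[OF tens(2)]])
    show "additive_map SC.T A (\<lambda>Y. counit C (cap \<phi> Y))"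
      by (rule additive_map_compose[OF cap_additive[OF tens(1)] linear_map_additive[OF C.counit_linear]])
    show "additive_map SC.T A (\<lambda>Y. \<phi> (tsum \<Sigma> (\<lambda>v c. ract \<Sigma> v (counit C c)) Y))"
      by (rule additive_map_compose[OF SC.tsum_additive[OF G bal] dual_additive[OF tens(1)]])
  qed (simp add: tens(1) counit_C_lact SC.tsum_tens[OF G bal] dual_ract counit_C_closed)
  then show ?case
    by (simp add: tens can_tens coaction_counit)
qed (simp add: can_add can_closed counit_C_add counit_add)

section \<open>Compatibility with the comultiplications\<close>

text \<open>\<open>cap2 \<phi>\<close> is \<open>\<phi> \<otimes> C \<otimes> C : \<Sigma> \<otimes>\<^sub>A (C \<otimes>\<^sub>A C) \<rightarrow> C \<otimes>\<^sub>A C\<close>.\<close>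

definition cap2 where
  "cap2 \<phi> = tsum CC.T (\<lambda>u X. lact CC.T (\<phi> u) X)"

lemma cap2_balanced:
  assumes "\<phi> \<in> carrier E"
  shows "balanced K A \<Sigma> CC.T CC.T (\<lambda>u X. lact CC.T (\<phi> u) X)"
  by (rule balancedI)
    (use assms in \<open>simp_all add: CC.lact_closed dual_add dual_ract dual_smult CC.T.lact_add_l CC.lact_add
      CC.T.lact_assoc CC.T.lact_smult_l CC.T.lact_smult_r\<close>)

lemma cap2_tens [simp]:
  "\<phi> \<in> carrier E \<Longrightarrow> u \<in> carrier \<Sigma> \<Longrightarrow> X \<in> carrier CC.T \<Longrightarrow> cap2 \<phi> (SCC.W.t u X) = lact CC.T (\<phi> u) X"
  unfolding cap2_def by (rule SCC.W.tsum_tens[OF CC_group cap2_balanced])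

lemma cap2_additive: "\<phi> \<in> carrier E \<Longrightarrow> additive_map SCC.W.T CC.T (cap2 \<phi>)"
  unfolding cap2_def by (rule SCC.W.tsum_additive[OF CC_group cap2_balanced])

text \<open>Left \<open>A\<close>-linearity of the comultiplication of \<open>C\<close> moves it
  past the scalar \<phi>(u). At Y = \<rho>(x) the right-hand side contracts one side of the
  coassociativity of the coaction.\<close>

lemma comult_cap:
  assumes \<phi>: "\<phi> \<in> carrier E" and Y: "Y \<in> carrier SC.T"
  shows "comult C (cap \<phi> Y) = cap2 \<phi> (tensor_map K A \<Sigma> CC.T (\<lambda>v. v) (comult C) Y)"
proof -
  note W = SCC.W.T.abelian_group_axioms
  have bal: "balanced K A \<Sigma> C SCC.W.T (\<lambda>u c. SCC.W.t u (comult C c))"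
    by (rule tensor_map_balanced[OF SC.tensor_pair_axioms SCC.W.tensor_pair_axioms
          linear_map_ident right_linear_ident C.comult_linear C.comult_left])
  show ?thesis
    unfolding tensor_map_def
  proof (rule SC.tensor_ext[OF _ _ _ Y])
    show "additive_map SC.T CC.T (\<lambda>Y. comult C (cap \<phi> Y))"
      by (rule additive_map_compose[OF cap_additive[OF \<phi>] linear_map_additive[OF C.comult_linear]])
    show "additive_map SC.T CC.T (\<lambda>Y. cap2 \<phi> (tsum SCC.W.T (\<lambda>u c. SCC.W.t u (comult C c)) Y))"
      by (rule additive_map_compose[OF SC.tsum_additive[OF W bal] cap2_additive[OF \<phi>]])
  qed (simp add: \<phi> comult_C_lact comult_C_closed SC.tsum_tens[OF W bal])
qed

lemma cap_rho_balanced: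
  assumes \<phi>: "\<phi> \<in> carrier E"
  shows "balanced K A \<Sigma> C CC.T (\<lambda>u c. CC.t (cap \<phi> (\<rho> u)) c)"
  by (rule balancedI)
    (use \<phi> in \<open>simp_all add: cap_closed rho_add cap_add CC.tens_add_l CC.tens_add_r rho_ract cap_ract
      CC.tens_act rho_smult cap_smult(1)[symmetric] cap_smult(2) CC.tens_smult\<close>)

text \<open>The contraction of the other side of coassociativity: since \<phi> meets only the first
  of three factors, it can be applied before reassociating.\<close>

lemma cap2_assoc:
  assumes \<phi>: "\<phi> \<in> carrier E" and Y: "Y \<in> carrier SC.T"
  shows "cap2 \<phi> (tensor_assoc K A A \<Sigma> C C (tensor_map K A SC.T C \<rho> (\<lambda>c. c) Y)) =
    tsum CC.T (\<lambda>u c. CC.t (cap \<phi> (\<rho> u)) c) Y"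
proof -
  \<comment> \<open>Generalised from \<rho>(u) to an arbitrary element of \<Sigma> \<otimes> C, so
    that induction on tensors applies.\<close>
  have inner: "cap2 \<phi> (tensor_assoc K A A \<Sigma> C C (SCC.PQV.t Z c)) = CC.t (cap \<phi> Z) c"
    if Z: "Z \<in> carrier SC.T" and c: "c \<in> carrier C" for Z c
    using Z
  proof (induction rule: SC.tensor_induct)
    case (add X Y)
    then show ?case
      using c \<phi> by (simp add: SCC.PQV.tens_add_l additive_map_add[OF SCC.assoc_additive]
          additive_map_closed[OF SCC.assoc_additive] additive_map_add[OF cap2_additive] cap_add
          cap_closed CC.tens_add_l)
  qed (simp add: c \<phi>)
  note V = SCC.PQV.T.abelian_group_axioms
  have bal: "balanced K A \<Sigma> C SCC.PQV.T (\<lambda>u c. SCC.PQV.t (\<rho> u) c)"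
    by (rule tensor_map_balanced[OF SC.tensor_pair_axioms SCC.PQV.tensor_pair_axioms
          coaction_linear coaction_right linear_map_ident left_linear_ident])
  show ?thesis
    unfolding tensor_map_def
  proof (rule SC.tsum_eqI[symmetric, OF CC_group cap_rho_balanced[OF \<phi>] _ Y])
    show "additive_map SC.T CC.T (\<lambda>Y. cap2 \<phi> (tensor_assoc K A A \<Sigma> C C
        (tsum SCC.PQV.T (\<lambda>u c. SCC.PQV.t (\<rho> u) c) Y)))"
      by (rule additive_map_compose[OF additive_map_compose[OF SC.tsum_additive[OF V bal]
            SCC.assoc_additive] cap2_additive[OF \<phi>]])
  qed (simp add: SC.tsum_tens[OF V bal] inner)
qed

lemma cap_pair_balanced:
  assumes \<phi>: "\<phi> \<in> carrier E" and Y: "Y \<in> carrier SC.T"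
  shows "balanced K A \<Sigma> E CC.T (\<lambda>e \<psi>. CC.t (cap \<phi> (\<rho> e)) (cap \<psi> Y))"
  by (rule balancedI)
    (use \<phi> Y in \<open>simp_all add: cap_closed rho_add cap_add additive_map_add[OF cap_additive_l]
      CC.tens_add_l CC.tens_add_r rho_ract cap_ract cap_lact CC.tens_act rho_smult
      cap_smult(1)[symmetric] cap_smult(2) CC.tens_smult\<close>)

text \<open>This turns the action of r into the sum over \<iota>(r) that occurs in the comatrix
  comultiplication. For Y = u \<otimes> c, r u = e_r \<phi>_r(u); right linearity of the coaction
  brings \<phi>_r(u) to the right end of the first leg, from where it crosses over to give
  \<phi>_r(u) c.\<close>

lemma cap_rho_lact:
  assumes \<phi>: "\<phi> \<in> carrier E" and r: "r \<in> carrier R" and Y: "Y \<in> carrier SC.T"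
  shows "tsum CC.T (\<lambda>u c. CC.t (cap \<phi> (\<rho> u)) c) (lact SC.T r Y) =
    tsum CC.T (\<lambda>e \<psi>. CC.t (cap \<phi> (\<rho> e)) (cap \<psi> Y)) (\<iota> r)"
proof (rule SC.tensor_ext[OF _ _ _ Y])
  note bal = cap_rho_balanced[OF \<phi>]
  show "additive_map SC.T CC.T (\<lambda>Y. tsum CC.T (\<lambda>u c. CC.t (cap \<phi> (\<rho> u)) c) (lact SC.T r Y))"
    by (rule additive_map_compose[OF SC.lact_additive[OF r] SC.tsum_additive[OF CC_group bal]])
  show "additive_map SC.T CC.T (\<lambda>Y. tsum CC.T (\<lambda>e \<psi>. CC.t (cap \<phi> (\<rho> e)) (cap \<psi> Y)) (\<iota> r))"
    by (rule SE.additive_tsum_param[OF CC_group _ cap_pair_balanced[OF \<phi>] iota_closed[OF r]])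
      (simp_all add: additive_mapI \<phi> cap_closed cap_add CC.tens_add_r)
  fix u c assume u: "u \<in> carrier \<Sigma>" and c: "c \<in> carrier C"
  have add: "additive_map \<Sigma> CC.T (\<lambda>z. CC.t (cap \<phi> (\<rho> z)) c)"
    by (rule additive_mapI) (simp_all add: \<phi> c cap_closed rho_add cap_add CC.tens_add_l)
  have "tsum CC.T (\<lambda>u c. CC.t (cap \<phi> (\<rho> u)) c) (lact SC.T r (SC.t u c)) =
      CC.t (cap \<phi> (\<rho> (tsum \<Sigma> (\<lambda>e \<psi>. ract \<Sigma> e (\<psi> u)) (\<iota> r)))) c"
    by (simp add: r u c lact_closed SC.tsum_tens[OF CC_group bal] lact_iota[symmetric])
  also have "\<dots> = tsum CC.T (\<lambda>e \<psi>. CC.t (cap \<phi> (\<rho> (ract \<Sigma> e (\<psi> u)))) c) (\<iota> r)"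
    by (rule SE.additive_tsum[OF M.abelian_group_axioms CC_group eval_balanced[OF u] add iota_closed[OF r]])
  also have "\<dots> = tsum CC.T (\<lambda>e \<psi>. CC.t (cap \<phi> (\<rho> e)) (cap \<psi> (SC.t u c))) (\<iota> r)"
    by (rule SE.tsum_cong[OF CC_group iota_closed[OF r]])
      (simp_all add: \<phi> u c rho_ract cap_ract cap_closed CC.tens_act C.lact_closed)
  finally show "tsum CC.T (\<lambda>u c. CC.t (cap \<phi> (\<rho> u)) c) (lact SC.T r (SC.t u c)) =
      tsum CC.T (\<lambda>e \<psi>. CC.t (cap \<phi> (\<rho> e)) (cap \<psi> (SC.t u c))) (\<iota> r)" .
qed

lemma can_linear: "linear_map K D.T C (can C \<rho>)"
  by (simp add: linear_map_def can_closed can_add can_smult)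

lemma can_right_linear: "right_linear A D.T C (can C \<rho>)"
  by (simp add: right_linear_def can_ract)

lemma can_left_linear: "left_linear A D.T C (can C \<rho>)"
  by (simp add: left_linear_def can_lact)

text \<open>Applying \<open>\<phi> \<otimes> C \<otimes> C\<close> to the coassociativity of \<open>\<rho>\<close> at \<open>r v\<close> gives the case \<open>X = \<phi> \<otimes> r v\<close>.\<close>

lemma comult_can:
  assumes "X \<in> carrier D.T"
  shows "comult C (can C \<rho> X) = tensor_map K A C C (can C \<rho>) (can C \<rho>) (comult Dc X)"
proof -
  let ?m = "tensor_map K A C C (can C \<rho>) (can C \<rho>)"
  have bal: "balanced K A D.T D.T CC.T (\<lambda>x y. CC.t (can C \<rho> x) (can C \<rho> y))"
    by (rule tensor_map_balanced[OF DD.tensor_pair_axioms CC.tensor_pair_axioms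
          can_linear can_right_linear can_linear can_left_linear])
  have add: "additive_map DD.T CC.T ?m"
    unfolding tensor_map_def by (rule DD.tsum_additive[OF CC_group bal])
  have tens: "?m (DD.t x y) = CC.t (can C \<rho> x) (can C \<rho> y)" if "x \<in> carrier D.T" "y \<in> carrier D.T" for x y
    unfolding tensor_map_def by (rule DD.tsum_tens[OF CC_group bal that])
  from assms show ?thesis
  proof (induction rule: comatrix_induct)
    case (lact \<phi> r v)
    then have rv: "lact \<Sigma> r v \<in> carrier \<Sigma>" by (simp add: lact_closed)
    have "comult C (can C \<rho> (D.t \<phi> (lact \<Sigma> r v))) =
        cap2 \<phi> (tensor_map K A \<Sigma> CC.T (\<lambda>v. v) (comult C) (\<rho> (lact \<Sigma> r v)))"
      using lact rv by (simp add: can_tens comult_cap)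
    also have "\<dots> = cap2 \<phi> (tensor_assoc K A A \<Sigma> C C (tensor_map K A SC.T C \<rho> (\<lambda>c. c) (\<rho> (lact \<Sigma> r v))))"
      by (simp add: coaction_coassoc[OF rv])
    also have "\<dots> = tsum CC.T (\<lambda>e \<psi>. CC.t (cap \<phi> (\<rho> e)) (cap \<psi> (\<rho> v))) (\<iota> r)"
      using lact rv by (simp add: cap2_assoc rho_lact[of r v] cap_rho_lact SC.lact_closed)
    \<comment> \<open>On a pure tensor e \<otimes> \<psi> the right-hand side maps (\<phi> \<otimes>
      e) \<otimes> (\<psi> \<otimes> v) leg by leg, and each leg becomes a contraction of the
      coaction.\<close>
    also have "\<dots> = ?m (cm \<phi> v (\<iota> r))"
      by (rule SE.tsum_eqI[OF CC_group cap_pair_balanced _ iota_closed])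
        (use lact in \<open>simp_all add: tens can_tens additive_map_compose[OF cm_additive add]\<close>)
    finally show ?case
      using lact by simp
  qed (simp add: can_add can_closed comult_C_add comult_add comult_closed additive_map_add[OF add])
qed

theorem coring_hom_can: "coring_hom K A Dc C (can C \<rho>)"
  unfolding coring_hom_def
proof (intro conjI ballI)
  show "linear_map K Dc C (can C \<rho>)" "left_linear A Dc C (can C \<rho>)" "right_linear A Dc C (can C \<rho>)"
    using can_linear can_left_linear can_right_linear
    by (simp_all add: linear_map_def left_linear_def right_linear_def)
qed (simp_all add: coring_comatrix C.coring_axioms comult_can counit_can)

end

theorem proposition4p3:
  fixes K :: "'k ring" and A :: "('k, 'a) module" and C :: "('k, 'a, 'c) coring"
    and R :: "('k, 'r) module" and \<Sigma> :: "('k, 'r, 'a, 's) bimodule"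
    and \<rho> :: "'s \<Rightarrow> ('s, 'c) tensor_elem"
    and \<iota> :: "'r \<Rightarrow> ('s, 's \<Rightarrow> 'a) tensor_elem"
  assumes "unital_algebra K A"
    and "coring K A C"
    and "right_comodule K A C \<Sigma> \<rho>"
    and "firm_ring K R"
    and "algebra_hom K R (dual_tensor_algebra K A \<Sigma>) \<iota>"
    and "\<And>r u. r \<in> carrier R \<Longrightarrow> u \<in> carrier \<Sigma> \<Longrightarrow> lact \<Sigma> r u = induced_action \<Sigma> \<iota> r u"
    and "bicomodule K R A C \<Sigma> \<rho>"
    and "firm_module K R \<Sigma>"
  shows "(\<forall>\<phi> \<in> carrier (dual A \<Sigma>). \<forall>x \<in> carrier \<Sigma>.
      can C \<rho> (tens K R (dual A \<Sigma>) \<Sigma> \<phi> x) = tsum C (\<lambda>u c. lact C (\<phi> u) c) (\<rho> x)) \<and>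
    coring_hom K A (comatrix_coring K R A \<Sigma> \<iota>) C (can C \<rho>)"
proof -
  interpret B: bicomodule K R A C \<Sigma> \<rho> by fact
  have "bimodule_dual K R A \<Sigma>" ..
  then have "comatrix K R A \<Sigma> \<iota>"
    using assms by (simp add: comatrix_def comatrix_axioms_def)
  then interpret comatrix_comodule K R A \<Sigma> \<iota> C \<rho>
    using assms(7) by (rule comatrix_comodule.intro)
  show ?thesis
    using coring_hom_can by (simp add: can_tens cap_def)
qed

end
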